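(* Let $d\in\{1,2,3\}$, let $\Omega\subset\mathbb{R}^d$ be a bounded domain with (strong) Lipschitz boundary, $T>0$, $I=(0,T)$, $\mu_0,m_0>0$ constants, and $0<\beta<\infty$. Let $h\in (H^s(I))^d$ with $s>\frac32$, $g\in (H^r(\Omega))^d$ with $r>\frac d2$, and $p\in (C^\infty(\overline{\Omega}))^d$. Let $H(x,t)=g(x)-h(t)$ and $$\kappa(x,t)=\mu_0m_0\,p(x)^t\frac{\mathrm{d}}{\mathrm{d}t}\left[\frac{\mathcal{L}_\beta(|H(x,t)|)}{|H(x,t)|}H(x,t)\right],$$ and let $F:L^2(\Omega)\to L^2(I)$ be the integral operator $(Fc)(t)=\int_\Omega c(x)\kappa(x,t)\,\mathrm{d}x$. Then the singular values $\sigma_n$ of $F$ (ordered nonincreasingly) satisfy $\sigma_n\le C n^{-\frac12-\frac rd}$ for all $n\ge1$, with a constant $C$ independent of $n$.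
   Context: The superscript $t$ on a vector denotes transpose and $|\cdot|$ is the Euclidean norm. The (scaled) Langevin function is $\mathcal{L}_\beta(z)=\coth(\beta z)-(\beta z)^{-1}$ (with $\mathcal{L}_\beta(0)=0$ by continuity), and $\mathcal{L}_\beta(|H|)/|H|$ is understood by its continuous extension where $H=0$. $H^s(I)$ and $H^r(\Omega)$ are the $L^2$-based Sobolev spaces (Sobolev--Slobodeckij for non-integer order). *)

theory Defs
  imports "HOL-Analysis.Analysis" "HOL-Real_Asymp.Real_Asymp"
begin

text \<open>
  Elements of \<open>L\<^sup>2(S)\<close> are represented by functions rather than by classes modulo null sets; values
  outside \<open>S\<close> are irrelevant.
\<close>

definition L2 :: "'a::euclidean_space set \<Rightarrow> ('a \<Rightarrow> real) set" where
  "L2 S = {f. f \<in> borel_measurable (lebesgue_on S) \<and> integrable (lebesgue_on S) (\<lambda>x. (f x)\<^sup>2)}"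

definition L2_inner :: "'a::euclidean_space set \<Rightarrow> ('a \<Rightarrow> real) \<Rightarrow> ('a \<Rightarrow> real) \<Rightarrow> real" where
  "L2_inner S f g = (\<integral>x. f x * g x \<partial>lebesgue_on S)"

text \<open>
  A multi-index is encoded as the list of basis directions in which one differentiates; its order
  is the length of the list.
\<close>

primrec partials :: "'a::euclidean_space list \<Rightarrow> ('a \<Rightarrow> real) \<Rightarrow> 'a \<Rightarrow> real" where
  "partials [] f = f"
| "partials (b # bs) f = (\<lambda>x. frechet_derivative (partials bs f) (at x) b)"

text \<open>For open \<open>S\<close> this is \<open>C\<^sup>\<infinity>(S)\<close>: all partial derivatives exist and are differentiable, hence
  continuous.\<close>

definition smooth_on :: "'a::euclidean_space set \<Rightarrow> ('a \<Rightarrow> real) \<Rightarrow> bool" where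
  "smooth_on S f \<longleftrightarrow> (\<forall>bs\<in>lists Basis. \<forall>x\<in>S. partials bs f differentiable (at x))"

text \<open>\<open>C\<^sup>\<infinity>\<close> of the closure of an open set \<open>S\<close>: functions that are smooth in \<open>S\<close> and all of whose
  partial derivatives extend continuously to the closure.\<close>

definition smooth_on_closure :: "'a::euclidean_space set \<Rightarrow> ('a \<Rightarrow> real) \<Rightarrow> bool" where
  "smooth_on_closure S f \<longleftrightarrow> smooth_on S f \<and>
     (\<forall>bs\<in>lists Basis. \<exists>G. continuous_on (closure S) G \<and> (\<forall>x\<in>S. G x = partials bs f x))"

definition test_function :: "'a::euclidean_space set \<Rightarrow> ('a \<Rightarrow> real) \<Rightarrow> bool" where
  "test_function S \<phi> \<longleftrightarrow> smooth_on UNIV \<phi> \<and> (\<exists>K. compact K \<and> K \<subseteq> S \<and> (\<forall>x. x \<notin> K \<longrightarrow> \<phi> x = 0))"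

definition has_weak_partials ::
    "'a::euclidean_space set \<Rightarrow> 'a list \<Rightarrow> ('a \<Rightarrow> real) \<Rightarrow> ('a \<Rightarrow> real) \<Rightarrow> bool" where
  "has_weak_partials S bs u v \<longleftrightarrow>
     (\<forall>\<phi>. test_function S \<phi> \<longrightarrow>
        L2_inner S u (partials bs \<phi>) = (-1) ^ length bs * L2_inner S v \<phi>)"

text \<open>The square of the Slobodeckij (Gagliardo) seminorm of order \<open>\<theta> \<in> (0,1)\<close>. The diagonal is a
  null set.\<close>

definition slobodeckij_energy ::
    "real \<Rightarrow> 'a::euclidean_space set \<Rightarrow> ('a \<Rightarrow> real) \<Rightarrow> ennreal" where
  "slobodeckij_energy \<theta> S v =
     (\<integral>\<^sup>+ x. (\<integral>\<^sup>+ y. ennreal ((v x - v y)\<^sup>2 / norm (x - y) powr (real DIM('a) + 2 * \<theta>))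
        \<partial>lebesgue_on S) \<partial>lebesgue_on S)"

text \<open>\<open>H\<^sup>s(S)\<close> for open \<open>S\<close> and \<open>s \<ge> 0\<close>. For integer \<open>s\<close> the condition on \<open>frac s\<close> is void and this
  is the classical space of functions with weak derivatives of order up to \<open>s\<close> in \<open>L\<^sup>2\<close>.\<close>

definition sobolev :: "real \<Rightarrow> 'a::euclidean_space set \<Rightarrow> ('a \<Rightarrow> real) set" where
  "sobolev s S = {u \<in> L2 S. \<forall>bs\<in>lists Basis. length bs \<le> nat \<lfloor>s\<rfloor> \<longrightarrow>
     (\<exists>v\<in>L2 S. has_weak_partials S bs u v \<and>
        (length bs = nat \<lfloor>s\<rfloor> \<and> frac s > 0 \<longrightarrow> slobodeckij_energy (frac s) S v < \<infinity>))}"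

text \<open>
  Near each boundary point, \<open>S\<close> is the strict epigraph of a Lipschitz function \<open>\<phi>\<close> in a suitable
  orthonormal coordinate system. The vertical coordinate direction is the unit vector \<open>e\<close>, and
  \<open>\<phi>\<close> is a function on the hyperplane through the origin orthogonal to \<open>e\<close> (in one dimension, a
  single point).
\<close>

definition lipschitz_boundary :: "'a::euclidean_space set \<Rightarrow> bool" where
  "lipschitz_boundary S \<longleftrightarrow>
     (\<forall>z\<in>frontier S. \<exists>e \<phi> L \<rho>. norm e = 1 \<and> \<rho> > 0 \<and>
        L-lipschitz_on {y. y \<bullet> e = 0} (\<phi> :: 'a \<Rightarrow> real) \<and>
        S \<inter> ball z \<rho> = {y \<in> ball z \<rho>. \<phi> (y - (y \<bullet> e) *\<^sub>R e) < y \<bullet> e})"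

definition bounded_lipschitz_domain :: "'a::euclidean_space set \<Rightarrow> bool" where
  "bounded_lipschitz_domain S \<longleftrightarrow>
     open S \<and> connected S \<and> S \<noteq> {} \<and> bounded S \<and> lipschitz_boundary S"

text \<open>\<open>z\<close> represents \<open>F\<^sup>* w\<close>, the value at \<open>w\<close> of the Hilbert space adjoint of
  \<open>F : L\<^sup>2(S) \<rightarrow> L\<^sup>2(S')\<close>.\<close>

definition adjoint_value :: "'a::euclidean_space set \<Rightarrow> 'b::euclidean_space set \<Rightarrow>
    (('a \<Rightarrow> real) \<Rightarrow> 'b \<Rightarrow> real) \<Rightarrow> ('b \<Rightarrow> real) \<Rightarrow> ('a \<Rightarrow> real) \<Rightarrow> bool" where
  "adjoint_value S S' F w z \<longleftrightarrow> z \<in> L2 S \<and> (\<forall>f\<in>L2 S. L2_inner S' (F f) w = L2_inner S f z)"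

text \<open>\<open>F\<^sup>* F u = \<tau>\<^sup>2 u\<close>\<close>

definition singular_function :: "'a::euclidean_space set \<Rightarrow> 'b::euclidean_space set \<Rightarrow>
    (('a \<Rightarrow> real) \<Rightarrow> 'b \<Rightarrow> real) \<Rightarrow> real \<Rightarrow> ('a \<Rightarrow> real) \<Rightarrow> bool" where
  "singular_function S S' F \<tau> u \<longleftrightarrow> u \<in> L2 S \<and> adjoint_value S S' F (F u) (\<lambda>x. \<tau>\<^sup>2 * u x)"

text \<open>
  The \<open>n\<close>-th singular value, \<open>n \<ge> 1\<close>, of a compact operator \<open>F : L\<^sup>2(S) \<rightarrow> L\<^sup>2(S')\<close>, i.e. the
  \<open>n\<close>-th entry of the nonincreasing list of the square roots of the eigenvalues of \<open>F\<^sup>* F\<close>, repeated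
  according to multiplicity: the largest \<open>\<mu>\<close> such that at least \<open>n\<close> entries, that is, entries
  belonging to \<open>n\<close> orthonormal eigenfunctions, are \<open>\<ge> \<mu>\<close>. It is \<open>0\<close> when fewer than \<open>n\<close> are positive.
\<close>

definition singular_value :: "'a::euclidean_space set \<Rightarrow> 'b::euclidean_space set \<Rightarrow>
    (('a \<Rightarrow> real) \<Rightarrow> 'b \<Rightarrow> real) \<Rightarrow> nat \<Rightarrow> real" where
  "singular_value S S' F n = Sup (insert 0 {\<mu>. \<mu> > 0 \<and>
     (\<exists>(u :: nat \<Rightarrow> 'a \<Rightarrow> real) \<tau>.
        (\<forall>i<n. \<mu> \<le> \<tau> i \<and> singular_function S S' F (\<tau> i) (u i)) \<and>
        (\<forall>i<n. \<forall>j<n. L2_inner S (u i) (u j) = (if i = j then 1 else 0)))})"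

definition langevin :: "real \<Rightarrow> real \<Rightarrow> real" where
  "langevin \<beta> z = (if z = 0 then 0 else cosh (\<beta> * z) / sinh (\<beta> * z) - 1 / (\<beta> * z))"

definition langevin_quotient :: "real \<Rightarrow> real \<Rightarrow> real" where
  "langevin_quotient \<beta> z = (if z = 0 then \<beta> / 3 else langevin \<beta> z / z)"

text \<open>The value at \<open>0\<close> is the one that makes the quotient continuous.\<close>

lemma langevin_quotient_tendsto:
  assumes "\<beta> > 0"
  shows "(langevin_quotient \<beta> \<longlongrightarrow> langevin_quotient \<beta> 0) (at 0)"
proof -
  have *: "((\<lambda>w::real. (cosh w / sinh w - 1 / w) / w) \<longlongrightarrow> 1 / 3) (at 0)"
    unfolding cosh_field_def sinh_field_def by real_asymp
  have "filterlim (\<lambda>z. \<beta> * z) (at 0) (at (0::real))"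
    using assms by real_asymp
  from filterlim_compose[OF * this]
  have "((\<lambda>z. \<beta> * ((cosh (\<beta> * z) / sinh (\<beta> * z) - 1 / (\<beta> * z)) / (\<beta> * z))) \<longlongrightarrow> \<beta> * (1 / 3)) (at 0)"
    by (rule tendsto_mult[OF tendsto_const])
  then show ?thesis
  proof (rule Lim_transform_eventually[THEN tendsto_eq_rhs])
    show "\<forall>\<^sub>F z in at 0. \<beta> * ((cosh (\<beta> * z) / sinh (\<beta> * z) - 1 / (\<beta> * z)) / (\<beta> * z))
        = langevin_quotient \<beta> z"
      using assms by (auto simp: eventually_at_filter langevin_quotient_def langevin_def)
  qed (simp add: langevin_quotient_def)
qed

end

theory Submission
  imports Defs
begin

text \<open>
  Let \<open>q\<close> be the Langevin quotient and \<open>G\<close> the Jacobian of the field \<open>y \<mapsto> q(|y|) y\<close>. For almost every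
  \<open>t\<close> the kernel is \<open>\<kappa>(x,t) = - \<mu>\<^sub>0 m\<^sub>0 p(x)\<^sup>t G(g(x) - h(t)) h'(t)\<close>. The partial fraction expansion of \<open>coth\<close>
  shows that every derivative of \<open>G\<close> is bounded on the whole space. Taylor expansion of \<open>G(g(x) - \<eta>)\<close> in
  \<open>\<eta> = h(t)\<close> around the points of a grid of mesh \<open>1/m\<close> in the bounded range of \<open>h\<close> therefore approximates
  \<open>\<kappa>\<close> by a sum of \<open>O(m\<^sup>d)\<close> products of a function of \<open>x\<close> and a function of \<open>t\<close>, up to
  \<open>O(m\<^sup>-\<^sup>N |h'(t)|)\<close> uniformly in \<open>x\<close>, for every \<open>N\<close>. More than \<open>O(m\<^sup>d)\<close> orthonormal singular functions
  have a normalized linear combination orthogonal to all these functions of \<open>x\<close>, on which \<open>F\<close> is small;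
  so \<open>N \<ge> d/2 + r\<close> gives the claimed rate.
\<close>

section \<open>Partial fractions of the Langevin function\<close>

text \<open>The Taylor polynomial is centred at \<open>g x - z\<close>, with \<open>z\<close> a grid
  point and increment \<open>z - h t\<close>. Its coefficients are functions of \<open>x\<close>
  that serve all \<open>t\<close> with \<open>h t\<close> near \<open>z\<close>, so grid points are
  counted and not times. Expanding in the value \<eta> and not in \<open>t\<close> keeps the limited
  regularity of \<open>h\<close> out of the estimate: \<open>h'\<close> enters only as a weight in
  \<open>L2\<close>, and the order N is free. The price is that G must have bounded derivatives of
  all orders at arguments not confined to a bounded set in advance. The formula with coth hides this
  at the origin, where both the norm and the quotient are singular; the partial fractions show a
  smooth function of |y|^2 whose k-th derivative decays at least like (1 + |y|^2)^(-k), enough to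
  absorb the polynomial factors that the chain rule creates. With n proportional to m^d the error
  m^(-N) is n^(-N/d), whence the condition on N. Since the definition of singular values provides
  orthonormal eigenfunctions, a dimension count in their span takes the place of the spectral
  theorem.\<close>

lemma summable_inverse_Suc_square: "summable (\<lambda>k. 1 / real (Suc k) ^ 2)"
  using inverse_squares_sums by (simp add: sums_iff add.commute)

text \<open>Euler's product for the sine at the imaginary point i x / pi: since sin (i x) = i sinh
  x, the factors 1 - z^2/k^2 become 1 + x^2/(k pi)^2.\<close>

lemma sinh_product:
  assumes "x \<noteq> 0"
  shows "(\<lambda>n. \<Prod>k<n. 1 + x\<^sup>2 / (real (Suc k) * pi)\<^sup>2) \<longlonglongrightarrow> sinh x / x"
proof -
  let ?z = "\<i> * of_real (x / pi) :: complex"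
  have z: "of_real pi * ?z = \<i> * of_real x"
    by simp
  have s: "sin (\<i> * complex_of_real x) = \<i> * of_real (sinh x)"
    by (simp add: sin_exp_eq sinh_def scaleR_conv_of_real exp_of_real flip: exp_of_real)
       (simp add: field_simps flip: exp_of_real)
  have "(\<lambda>n. \<i> * of_real (x * (\<Prod>k<n. 1 + x\<^sup>2 / (real (Suc k) * pi)\<^sup>2))) \<longlonglongrightarrow> \<i> * complex_of_real (sinh x)"
  proof -
    have "(\<Prod>k=1..n. 1 - ?z\<^sup>2 / of_nat k ^ 2) = of_real (\<Prod>k<n. 1 + x\<^sup>2 / (real (Suc k) * pi)\<^sup>2)" for n
    proof -
      have "(\<Prod>k=1..n. 1 - ?z\<^sup>2 / of_nat k ^ 2) = (\<Prod>k<n. 1 - ?z\<^sup>2 / of_nat (Suc k) ^ 2)"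
        by (rule prod.reindex_bij_witness[of _ Suc "\<lambda>k. k - 1"]) auto
      also have "\<dots> = (\<Prod>k<n. of_real (1 + x\<^sup>2 / (real (Suc k) * pi)\<^sup>2))"
        by (intro prod.cong refl) (simp add: power_mult_distrib power_divide mult.commute)
      finally show ?thesis
        by simp
    qed
    then show ?thesis
      using sin_product_formula_complex[of ?z] unfolding z s by (simp add: mult.assoc)
  qed
  then have "(\<lambda>n. complex_of_real (x * (\<Prod>k<n. 1 + x\<^sup>2 / (real (Suc k) * pi)\<^sup>2))) \<longlonglongrightarrow> of_real (sinh x)"
    by (subst (asm) tendsto_mult_left_iff) auto
  then have "(\<lambda>n. x * (\<Prod>k<n. 1 + x\<^sup>2 / (real (Suc k) * pi)\<^sup>2)) \<longlonglongrightarrow> sinh x"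
    by (subst (asm) tendsto_of_real_iff)
  from tendsto_divide[OF this tendsto_const[of x] assms] show ?thesis
    using assms by simp
qed

lemma ln_sinh_sums:
  assumes "x > 0"
  shows "(\<lambda>k. ln (1 + x\<^sup>2 / (real (Suc k) * pi)\<^sup>2)) sums ln (sinh x / x)"
proof -
  have "(\<lambda>n. ln (\<Prod>k<n. 1 + x\<^sup>2 / (real (Suc k) * pi)\<^sup>2)) \<longlonglongrightarrow> ln (sinh x / x)"
    using assms by (intro tendsto_ln sinh_product) auto
  moreover have "ln (\<Prod>k<n. 1 + x\<^sup>2 / (real (Suc k) * pi)\<^sup>2) = (\<Sum>k<n. ln (1 + x\<^sup>2 / (real (Suc k) * pi)\<^sup>2))" for n
  proof (rule ln_prod)
    show "1 + x\<^sup>2 / (real (Suc k) * pi)\<^sup>2 \<noteq> 0" for k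
      by (metis add_pos_nonneg less_irrefl zero_le_divide_iff zero_le_power2 zero_less_one)
  qed simp
  ultimately show ?thesis
    by (simp add: sums_def)
qed

text \<open>The logarithmic derivative of the product for sinh x / x, computed once term by term and
  once from ln (sinh x) - ln x.\<close>

lemma coth_partial_fractions:
  assumes "x > 0"
  shows "cosh x / sinh x - 1 / x = (\<Sum>k. 2 * x / (x\<^sup>2 + (real (Suc k) * pi)\<^sup>2))"
proof -
  let ?f = "\<lambda>k y. ln (1 + y\<^sup>2 / (real (Suc k) * pi)\<^sup>2)"
    and ?f' = "\<lambda>k y. 2 * y / (y\<^sup>2 + (real (Suc k) * pi)\<^sup>2)"
  \<comment> \<open>The upper end x + 1 gives the M-test a bound for the numerators 2 y of the
    differentiated terms.\<close>
  let ?S = "{0<..<x + 1}"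
  have d: "((\<lambda>y. \<Sum>k. ?f k y) has_field_derivative (\<Sum>k. ?f' k x)) (at x)"
  proof (rule has_field_derivative_series'(2)[of ?S])
    show "(?f k has_field_derivative ?f' k y) (at y within ?S)" if "y \<in> ?S" for k y
    proof -
      have *: "(real (Suc k) * pi)\<^sup>2 > 0" and "y\<^sup>2 > 0"
        using that by auto
      from * have **: "1 + y\<^sup>2 / (real (Suc k) * pi)\<^sup>2 > 0"
        by (intro add_pos_nonneg) auto
      show ?thesis
        using * ** that \<open>y\<^sup>2 > 0\<close>
        by (auto intro!: derivative_eq_intros simp: add_pos_pos divide_simps simp del: of_nat_Suc)
    qed
    show "uniformly_convergent_on ?S (\<lambda>n y. \<Sum>k<n. ?f' k y)"
    proof (rule Weierstrass_m_test')
      show "norm (?f' k y) \<le> 2 * (x + 1) / pi\<^sup>2 * (1 / real (Suc k) ^ 2)" if "y \<in> ?S" for k y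
      proof -
        have "norm (?f' k y) = 2 * y / (y\<^sup>2 + (real (Suc k) * pi)\<^sup>2)"
          using that by simp
        also have "\<dots> \<le> 2 * (x + 1) / (real (Suc k) * pi)\<^sup>2"
          using that by (intro frac_le) auto
        finally show ?thesis
          by (simp add: power_mult_distrib mult.commute)
      qed
    qed (intro summable_mult summable_inverse_Suc_square)
    show "summable (\<lambda>k. ?f k x)"
      using ln_sinh_sums[OF assms] by (simp add: sums_iff)
  qed (use assms in \<open>auto simp: interior_open\<close>)
  moreover have "((\<lambda>y. \<Sum>k. ?f k y) has_field_derivative (cosh x / sinh x - 1 / x)) (at x)"
  proof (rule has_field_derivative_transform_within_open[of _ _ _ "{0<..}"])
    have "((\<lambda>y. ln (sinh y) - ln y) has_field_derivative (cosh x / sinh x - 1 / x)) (at x)"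
      using assms by (auto intro!: derivative_eq_intros simp: field_simps)
    then show "((\<lambda>y. ln (sinh y / y)) has_field_derivative (cosh x / sinh x - 1 / x)) (at x)"
      by (rule has_field_derivative_transform_within_open[of _ _ _ "{0<..}"])
        (use assms in \<open>auto simp: ln_div\<close>)
    show "ln (sinh y / y) = (\<Sum>k. ?f k y)" if "y \<in> {0<..}" for y
      using ln_sinh_sums that by (simp add: sums_iff)
  qed (use assms in auto)
  ultimately show ?thesis
    by (metis DERIV_unique)
qed

text \<open>For \<open>a = pi / \<beta>\<close>, \<open>m = 0\<close> and u = z^2 this is the
  Langevin quotient up to the factor 2/\<beta>, and m counts derivatives in u up to a constant
  factor. The variable u stands for the squared norm, which is smooth at the origin.\<close>

definition inverse_power_sum :: "real \<Rightarrow> nat \<Rightarrow> real \<Rightarrow> real" where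
  "inverse_power_sum a m u = (\<Sum>k. 1 / (u + (a * real (Suc k))\<^sup>2) ^ Suc m)"

text \<open>Of the m + 1 factors, m are compared with the one for k = 0, which preserves the decay
  in u; the last one is compared with its value at u = 0, which is summable in k.\<close>

lemma inverse_power_sum_term_le:
  assumes "a > 0" "u \<ge> 0"
  shows "1 / (u + (a * real (Suc k))\<^sup>2) ^ Suc m \<le> (1 / (u + a\<^sup>2)) ^ m * (1 / a\<^sup>2) * (1 / real (Suc k) ^ 2)"
proof -
  have le: "a\<^sup>2 \<le> (a * real (Suc k))\<^sup>2"
    using assms by (intro power_mono) (auto simp: algebra_simps)
  have pos: "a\<^sup>2 > 0"
    using assms by simp
  then have "u + a\<^sup>2 > 0"
    using assms by linarith
  have "1 / (u + (a * real (Suc k))\<^sup>2) ^ Suc m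
      = (1 / (u + (a * real (Suc k))\<^sup>2)) ^ m * (1 / (u + (a * real (Suc k))\<^sup>2))"
    by (simp add: power_divide)
  also have "\<dots> \<le> (1 / (u + a\<^sup>2)) ^ m * (1 / (a * real (Suc k))\<^sup>2)"
    using pos \<open>u + a\<^sup>2 > 0\<close> le assms by (intro mult_mono power_mono frac_le) auto
  finally show ?thesis
    by (simp add: power_mult_distrib del: power_Suc of_nat_Suc)
qed

lemma summable_inverse_power_sum:
  assumes "a > 0" "u \<ge> 0"
  shows "summable (\<lambda>k. 1 / (u + (a * real (Suc k))\<^sup>2) ^ Suc m)"
proof (rule summable_comparison_test'[OF summable_mult[OF summable_inverse_Suc_square], of 0])
  show "norm (1 / (u + (a * real (Suc k))\<^sup>2) ^ Suc m)
      \<le> (1 / (u + a\<^sup>2)) ^ m * (1 / a\<^sup>2) * (1 / real (Suc k) ^ 2)" for k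
    using inverse_power_sum_term_le[OF assms, of k m] assms(2) by simp
qed

text \<open>A polynomial of degree 2 m in y grows at most like (1 + u)^m for u = |y|^2; this is the
  estimate that keeps the functions in \<open>radial_symbols\<close> bounded.\<close>

lemma inverse_power_sum_bounds:
  assumes "a > 0"
  obtains C where "\<And>u. u \<ge> 0 \<Longrightarrow> \<bar>inverse_power_sum a m u\<bar> * (1 + u) ^ m \<le> C"
proof
  let ?S = "\<Sum>k. 1 / real (Suc k) ^ 2"
  fix u :: real assume u: "u \<ge> 0"
  have "inverse_power_sum a m u \<le> (\<Sum>k. (1 / (u + a\<^sup>2)) ^ m * (1 / a\<^sup>2) * (1 / real (Suc k) ^ 2))"
    unfolding inverse_power_sum_def
    by (intro suminf_le inverse_power_sum_term_le summable_inverse_power_sum summable_mult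
        summable_inverse_Suc_square assms u)
  also have "\<dots> = (1 / (u + a\<^sup>2)) ^ m * (1 / a\<^sup>2) * ?S"
    by (intro suminf_mult summable_inverse_Suc_square)
  finally have *: "inverse_power_sum a m u \<le> (1 / (u + a\<^sup>2)) ^ m * (1 / a\<^sup>2) * ?S" .
  have "inverse_power_sum a m u \<ge> 0"
    unfolding inverse_power_sum_def
    by (intro suminf_nonneg summable_inverse_power_sum assms u) (use u in auto)
  moreover have "((1 + u) / (u + a\<^sup>2)) ^ m \<le> (1 + 1 / a\<^sup>2) ^ m"
  proof (rule power_mono)
    have "a\<^sup>2 > 0" "u + a\<^sup>2 > 0"
      using assms u by (simp_all add: add_nonneg_pos)
    then show "(1 + u) / (u + a\<^sup>2) \<le> 1 + 1 / a\<^sup>2" "0 \<le> (1 + u) / (u + a\<^sup>2)"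
      using u by (auto simp: field_simps)
  qed
  moreover have "?S \<ge> 0"
    by (intro suminf_nonneg summable_inverse_Suc_square) auto
  ultimately have "\<bar>inverse_power_sum a m u\<bar> * (1 + u) ^ m
      \<le> (1 / (u + a\<^sup>2)) ^ m * (1 / a\<^sup>2) * ?S * (1 + u) ^ m"
    using * u by (intro mult_right_mono) auto
  also have "\<dots> = ((1 + u) / (u + a\<^sup>2)) ^ m * (1 / a\<^sup>2 * ?S)"
    by (simp add: power_divide)
  also have "\<dots> \<le> (1 + 1 / a\<^sup>2) ^ m * (1 / a\<^sup>2 * ?S)"
    using \<open>?S \<ge> 0\<close> \<open>_ \<le> (1 + 1 / a\<^sup>2) ^ m\<close> by (intro mult_right_mono mult_nonneg_nonneg) auto
  finally show "\<bar>inverse_power_sum a m u\<bar> * (1 + u) ^ m \<le> (1 + 1 / a\<^sup>2) ^ m * (1 / a\<^sup>2 * ?S)" .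
qed

text \<open>The derivative is taken relative to \<open>{0..}\<close>, the range of
  \<open>y \<bullet> y\<close>, since the terms have poles at negative u. One majorant, taken at u =
  0, dominates the differentiated terms for all u \<ge> 0, which permits termwise
  differentiation.\<close>

lemma has_field_derivative_inverse_power_sum:
  assumes "a > 0" "u \<ge> 0"
  shows "(inverse_power_sum a m has_field_derivative - real (Suc m) * inverse_power_sum a (Suc m) u)
    (at u within {0..})"
proof -
  let ?f = "\<lambda>k u. 1 / (u + (a * real (Suc k))\<^sup>2) ^ Suc m"
    and ?f' = "\<lambda>k u. - real (Suc m) * (1 / (u + (a * real (Suc k))\<^sup>2) ^ Suc (Suc m))"
  have "uniformly_convergent_on {0..} (\<lambda>n u. \<Sum>k<n. ?f' k u)"
  proof (rule Weierstrass_m_test')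
    fix k and u :: real assume "u \<in> {0..}"
    then have u: "u \<ge> 0" by simp
    have "norm (?f' k u) = real (Suc m) * (1 / (u + (a * real (Suc k))\<^sup>2) ^ Suc (Suc m))"
      using u by (simp add: abs_mult)
    also have "\<dots> \<le> real (Suc m) * ((1 / (u + a\<^sup>2)) ^ Suc m * (1 / a\<^sup>2) * (1 / real (Suc k) ^ 2))"
      by (intro mult_left_mono inverse_power_sum_term_le assms u) simp
    also have "\<dots> \<le> real (Suc m) * ((1 / a\<^sup>2) ^ Suc m * (1 / a\<^sup>2) * (1 / real (Suc k) ^ 2))"
      using assms u by (intro mult_left_mono mult_right_mono power_mono frac_le) auto
    also have "\<dots> = real (Suc m) * ((1 / a\<^sup>2) ^ Suc m * (1 / a\<^sup>2)) * (1 / real (Suc k) ^ 2)"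
      by simp
    finally show "norm (?f' k u) \<le> real (Suc m) * ((1 / a\<^sup>2) ^ Suc m * (1 / a\<^sup>2)) * (1 / real (Suc k) ^ 2)" .
  qed (intro summable_mult summable_inverse_Suc_square)
  then have lim: "uniform_limit {0..} (\<lambda>n u. \<Sum>k<n. ?f' k u) (\<lambda>u. \<Sum>k. ?f' k u) sequentially"
    by (simp add: uniformly_convergent_uniform_limit_iff suminf_eq_lim)
  have "\<exists>g. \<forall>u\<in>{0..}. (\<lambda>k. ?f k u) sums g u \<and> (g has_field_derivative (\<Sum>k. ?f' k u)) (at u within {0..})"
  proof (rule has_field_derivative_series[OF _ _ lim])
    show "(?f k has_field_derivative ?f' k u) (at u within {0..})" if "u \<in> {0..}" for k u
    proof -
      let ?c = "(a * real (Suc k))\<^sup>2"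
      have pos: "u + ?c > 0"
        using that assms by (simp add: add_nonneg_pos)
      have "((\<lambda>u. inverse ((u + ?c) ^ Suc m)) has_field_derivative
          - inverse ((u + ?c) ^ Suc m) * (real (Suc m) * (u + ?c) ^ m) * inverse ((u + ?c) ^ Suc m)) (at u within {0..})"
        using pos by (auto intro!: derivative_eq_intros simp del: power_Suc of_nat_Suc)
      moreover have "inverse ((u + ?c) ^ Suc m) * (real (Suc m) * (u + ?c) ^ m) * inverse ((u + ?c) ^ Suc m)
          = real (Suc m) * (1 / (u + ?c) ^ Suc (Suc m))"
      proof -
        have "inverse (w ^ Suc m) * (real (Suc m) * w ^ m) * inverse (w ^ Suc m) = real (Suc m) * (1 / w ^ Suc (Suc m))"
          if "w > 0" for w :: real
          using that by (simp add: field_simps del: of_nat_Suc)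
        from this[OF pos] show ?thesis .
      qed
      ultimately show ?thesis
        by (simp add: inverse_eq_divide del: power_Suc of_nat_Suc)
    qed
    show "summable (\<lambda>k. ?f k 0)"
      by (rule summable_inverse_power_sum) (use assms in auto)
  qed auto
  then obtain g where g: "\<And>u. u \<ge> 0 \<Longrightarrow> (\<lambda>k. ?f k u) sums g u"
      "\<And>u. u \<ge> 0 \<Longrightarrow> (g has_field_derivative (\<Sum>k. ?f' k u)) (at u within {0..})"
    by auto
  have "(\<Sum>k. ?f' k u) = - real (Suc m) * inverse_power_sum a (Suc m) u"
    unfolding inverse_power_sum_def by (intro suminf_mult summable_inverse_power_sum assms)
  then have "(g has_field_derivative - real (Suc m) * inverse_power_sum a (Suc m) u) (at u within {0..})"
    using g(2)[OF assms(2)] by simp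
  then show ?thesis
    by (rule has_field_derivative_transform_within[of _ _ _ _ 1])
       (use g(1) assms in \<open>auto simp: inverse_power_sum_def sums_iff\<close>)
qed

text \<open>At z = 0 this is the Basel sum: (2/\<beta>) (\<beta>/pi)^2 pi^2/6 = \<beta>/3. For z > 0
  each denominator in the series for coth at \<beta> z is \<beta>^2 times one of
  \<open>inverse_power_sum\<close>.\<close>

lemma langevin_quotient_eq:
  assumes "\<beta> > 0" "z \<ge> 0"
  shows "langevin_quotient \<beta> z = 2 / \<beta> * inverse_power_sum (pi / \<beta>) 0 (z\<^sup>2)"
proof (cases "z = 0")
  case True
  have "inverse_power_sum (pi / \<beta>) 0 0 = (\<Sum>k. (\<beta> / pi)\<^sup>2 * (1 / real (Suc k) ^ 2))"
    unfolding inverse_power_sum_def using assms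
    by (intro suminf_cong) (simp add: power_divide power_mult_distrib)
  also have "\<dots> = (\<beta> / pi)\<^sup>2 * (pi\<^sup>2 / 6)"
    using inverse_squares_sums by (subst suminf_mult[OF summable_inverse_Suc_square]) (simp add: sums_iff add.commute)
  finally show ?thesis
    using True assms by (simp add: langevin_quotient_def field_simps power2_eq_square)
next
  case False
  then have z: "z > 0" using assms by simp
  have "langevin_quotient \<beta> z = (\<Sum>k. 2 * (\<beta> * z) / ((\<beta> * z)\<^sup>2 + (real (Suc k) * pi)\<^sup>2)) / z"
    using coth_partial_fractions[of "\<beta> * z"] z assms
    by (simp add: langevin_quotient_def langevin_def)
  also have "(\<lambda>k. 2 * (\<beta> * z) / ((\<beta> * z)\<^sup>2 + (real (Suc k) * pi)\<^sup>2))
      = (\<lambda>k. 2 * z / \<beta> * (1 / (z\<^sup>2 + (pi / \<beta> * real (Suc k))\<^sup>2) ^ Suc 0))"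
  proof
    fix k
    have "(\<beta> * z)\<^sup>2 + (real (Suc k) * pi)\<^sup>2 = \<beta>\<^sup>2 * (z\<^sup>2 + (pi / \<beta> * real (Suc k))\<^sup>2)"
      using assms by (simp add: power_mult_distrib power_divide field_simps)
    then show "2 * (\<beta> * z) / ((\<beta> * z)\<^sup>2 + (real (Suc k) * pi)\<^sup>2) = 2 * z / \<beta> * (1 / (z\<^sup>2 + (pi / \<beta> * real (Suc k))\<^sup>2) ^ Suc 0)"
      using assms by (simp add: power2_eq_square)
  qed
  also have "(\<Sum>k. \<dots> k) = 2 * z / \<beta> * inverse_power_sum (pi / \<beta>) 0 (z\<^sup>2)"
    unfolding inverse_power_sum_def using assms by (intro suminf_mult summable_inverse_power_sum) auto
  finally show ?thesis using z by simp
qed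

section \<open>Taylor expansion in classes closed under differentiation\<close>

text \<open>A whole class is considered so that higher derivatives never have to be computed:
  membership alone gives smoothness, and boundedness of all members bounds every partial
  derivative.\<close>

definition differentiation_closed :: "('a::euclidean_space \<Rightarrow> real) set \<Rightarrow> bool" where
  "differentiation_closed \<F> \<longleftrightarrow>
     (\<forall>f\<in>\<F>. \<exists>f'. (\<forall>y. (f has_derivative f' y) (at y)) \<and> (\<forall>v. (\<lambda>y. f' y v) \<in> \<F>))"

lemma partials_mem:
  assumes "differentiation_closed \<F>" "f \<in> \<F>"
  shows "partials bs f \<in> \<F>"
proof (induction bs)
  case (Cons b bs)
  then obtain f' where f': "\<And>y. (partials bs f has_derivative f' y) (at y)" "\<And>v. (\<lambda>y. f' y v) \<in> \<F>"
    using assms unfolding differentiation_closed_def by blast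
  have "partials (b # bs) f = (\<lambda>y. f' y b)"
    using frechet_derivative_at[OF f'(1)] by (auto simp: fun_eq_iff)
  then show ?case
    using f'(2) by metis
qed (use assms in auto)

lemma partials_differentiable:
  assumes "differentiation_closed \<F>" "f \<in> \<F>"
  shows "partials bs f differentiable (at y)"
  using partials_mem[OF assms, of bs] assms(1)
  unfolding differentiation_closed_def differentiable_def by blast

lemma smooth_on_differentiation_closed:
  assumes "differentiation_closed \<F>" "f \<in> \<F>"
  shows "smooth_on S f"
  unfolding smooth_on_def using partials_differentiable[OF assms] by blast

lemma partials_has_derivative:
  assumes "differentiation_closed \<F>" "f \<in> \<F>"
  shows "(partials bs f has_derivative (\<lambda>v. \<Sum>b\<in>Basis. (v \<bullet> b) * partials (b # bs) f y)) (at y)"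
proof -
  let ?D = "frechet_derivative (partials bs f) (at y)"
  have D: "(partials bs f has_derivative ?D) (at y)"
    using partials_differentiable[OF assms] frechet_derivative_works by blast
  then have "linear ?D"
    by (rule has_derivative_linear)
  then have "?D v = (\<Sum>b\<in>Basis. (v \<bullet> b) * ?D b)" for v
    by (subst euclidean_representation[of v, symmetric]) (simp only: linear_sum linear_scale real_scaleR_def)
  then have "?D = (\<lambda>v. \<Sum>b\<in>Basis. (v \<bullet> b) * partials (b # bs) f y)"
    unfolding partials.simps by (rule ext)
  with D show ?thesis
    by (rule has_derivative_eq_rhs)
qed

definition directions :: "nat \<Rightarrow> 'a::euclidean_space list set" where
  "directions k = {bs. set bs \<subseteq> Basis \<and> length bs = k}"

lemma finite_directions: "finite (directions k)"
  unfolding directions_def by (rule finite_lists_length_eq) simp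

text \<open>The k-th derivative of f at w along v. As the lists are ordered, a multi-index is
  counted with its multinomial multiplicity, so Taylor's formula carries plain factors 1/k!.\<close>

definition taylor_term :: "nat \<Rightarrow> ('a::euclidean_space \<Rightarrow> real) \<Rightarrow> 'a \<Rightarrow> 'a \<Rightarrow> real" where
  "taylor_term k f w v = (\<Sum>bs\<in>directions k. (\<Prod>b\<leftarrow>bs. v \<bullet> b) * partials bs f w)"

lemma taylor_term_0 [simp]: "taylor_term 0 f w v = f w"
proof -
  have "directions 0 = {[] :: 'a list}"
    by (auto simp: directions_def)
  then show ?thesis
    by (simp add: taylor_term_def)
qed

text \<open>With the first entry of each list split off, the right side is visibly the derivative of
  \<open>taylor_term k f\<close> in its base point along \<open>v\<close>.\<close>

lemma taylor_term_Suc: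
  "taylor_term (Suc k) f w v =
    (\<Sum>bs\<in>directions k. (\<Prod>b\<leftarrow>bs. v \<bullet> b) * (\<Sum>b\<in>Basis. (v \<bullet> b) * partials (b # bs) f w))"
proof -
  have inj: "inj_on (\<lambda>(xs, n). n # xs) (directions k \<times> Basis)"
    by (auto simp: inj_on_def)
  show ?thesis
    unfolding taylor_term_def directions_def lists_length_Suc_eq
    by (subst sum.reindex[OF inj[unfolded directions_def]])
       (simp add: sum.cartesian_product sum_distrib_left mult_ac case_prod_unfold o_def)
qed

text \<open>Taylor's formula on the segment from w to w + v, reduced to one variable. The constant
  serves all w and v because each of the finitely many derivatives of order N is bounded on the
  whole space.\<close>

lemma taylor_bound:
  fixes f :: "'a::euclidean_space \<Rightarrow> real"
  assumes \<F>: "differentiation_closed \<F>" "f \<in> \<F>" and bounded: "\<And>f. f \<in> \<F> \<Longrightarrow> bounded (range f)"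
    and "N > 0"
  obtains C where "C \<ge> 0" "\<And>w v. \<bar>f (w + v) - (\<Sum>k<N. taylor_term k f w v / fact k)\<bar> \<le> C * norm v ^ N"
proof -
  have "\<exists>C. \<forall>w. \<bar>partials bs f w\<bar> \<le> C" for bs
    using bounded[OF partials_mem[OF \<F>]] by (auto simp: bounded_iff)
  then obtain B where B: "\<And>bs w. \<bar>partials bs f w\<bar> \<le> B bs"
    by metis
  have B0: "B bs \<ge> 0" for bs
    using B[of bs undefined] by linarith
  show thesis
  proof
    show "(\<Sum>bs\<in>directions N. B bs) \<ge> 0"
      by (intro sum_nonneg B0)
    fix w v :: 'a
    have "((\<lambda>t. taylor_term k f (w + t *\<^sub>R v) v) has_field_derivative taylor_term (Suc k) f (w + t *\<^sub>R v) v) (at t)"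
      for k t
    proof -
      have "((\<lambda>t. partials bs f (w + t *\<^sub>R v)) has_field_derivative
          (\<Sum>b\<in>Basis. (v \<bullet> b) * partials (b # bs) f (w + t *\<^sub>R v))) (at t)" for bs
      proof -
        have "((\<lambda>t. w + t *\<^sub>R v) has_derivative (\<lambda>s. s *\<^sub>R v)) (at t)"
          by (auto intro!: derivative_eq_intros)
        from has_derivative_compose[OF this partials_has_derivative[OF \<F>]]
        show ?thesis
          unfolding has_field_derivative_def
          by (rule has_derivative_eq_rhs) (auto simp: fun_eq_iff sum_distrib_left mult_ac)
      qed
      then show ?thesis
        unfolding taylor_term_Suc unfolding taylor_term_def
        by (auto intro!: DERIV_sum DERIV_cmult)
    qed
    then obtain t where t: "f (w + v) = (\<Sum>k<N. taylor_term k f w v / fact k)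
        + taylor_term N f (w + t *\<^sub>R v) v / fact N"
      using Maclaurin[of 1 N "\<lambda>k t. taylor_term k f (w + t *\<^sub>R v) v" "\<lambda>t. f (w + t *\<^sub>R v)"] \<open>N > 0\<close>
      by (auto simp: taylor_term_0)
    have "\<bar>taylor_term N f (w + t *\<^sub>R v) v / fact N\<bar> \<le> \<bar>taylor_term N f (w + t *\<^sub>R v) v\<bar>"
      by (simp add: abs_divide divide_le_eq mult_le_cancel_left1)
    also have "\<dots> \<le> (\<Sum>bs\<in>directions N. norm v ^ N * B bs)"
      unfolding taylor_term_def
    proof (rule order_trans[OF sum_abs], rule sum_mono)
      fix bs :: "'a list" assume bs: "bs \<in> directions N"
      have "\<bar>\<Prod>b\<leftarrow>bs. v \<bullet> b\<bar> \<le> norm v ^ length bs" if "set bs \<subseteq> Basis"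
        using that
      proof (induction bs)
        case (Cons b bs)
        then show ?case
          by (auto simp: abs_mult Basis_le_norm intro!: mult_mono)
      qed simp
      then show "\<bar>(\<Prod>b\<leftarrow>bs. v \<bullet> b) * partials bs f (w + t *\<^sub>R v)\<bar> \<le> norm v ^ N * B bs"
        using bs B unfolding abs_mult directions_def by (intro mult_mono) auto
    qed
    also have "\<dots> = (\<Sum>bs\<in>directions N. B bs) * norm v ^ N"
      by (simp add: sum_distrib_right mult.commute)
    finally show "\<bar>f (w + v) - (\<Sum>k<N. taylor_term k f w v / fact k)\<bar> \<le> (\<Sum>bs\<in>directions N. B bs) * norm v ^ N"
      unfolding t by simp
  qed
qed

section \<open>Polynomials times radial sums: a bounded class closed under differentiation\<close>

inductive polynomial_of_degree :: "nat \<Rightarrow> ('a::euclidean_space \<Rightarrow> real) \<Rightarrow> bool" where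
  const: "polynomial_of_degree n (\<lambda>_. c)"
| inner: "polynomial_of_degree n f \<Longrightarrow> polynomial_of_degree (Suc n) (\<lambda>y. (y \<bullet> b) * f y)"
| add: "polynomial_of_degree n f \<Longrightarrow> polynomial_of_degree n g \<Longrightarrow> polynomial_of_degree n (\<lambda>y. f y + g y)"

lemma polynomial_of_degree_Suc: "polynomial_of_degree n f \<Longrightarrow> polynomial_of_degree (Suc n) f"
proof (induction rule: polynomial_of_degree.induct)
  case (const n c)
  show ?case by (rule polynomial_of_degree.const)
next
  case (inner n f b)
  then show ?case by (intro polynomial_of_degree.inner)
next
  case (add n f g)
  show ?case by (rule polynomial_of_degree.add) (rule add.IH)+
qed

lemma polynomial_of_degree_scale: "polynomial_of_degree n f \<Longrightarrow> polynomial_of_degree n (\<lambda>y. c * f y)"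
proof (induction rule: polynomial_of_degree.induct)
  case (inner n f b)
  from polynomial_of_degree.inner[OF inner.IH, of b] show ?case
    by (simp add: mult_ac)
next
  case (add n f g)
  from polynomial_of_degree.add[OF add.IH] show ?case
    by (simp add: distrib_left)
qed (rule polynomial_of_degree.const)

text \<open>The bound n is kept although the degree may drop: when the derivative falls on the
  polynomial factor of a radial symbol, m and with it the bound 2 m stay the same.\<close>

lemma polynomial_of_degree_has_derivative:
  assumes "polynomial_of_degree n f"
  obtains f' where "\<And>y. (f has_derivative f' y) (at y)" "\<And>v. polynomial_of_degree n (\<lambda>y. f' y v)"
  using assms
proof (induction arbitrary: thesis rule: polynomial_of_degree.induct)
  case (const n c)
  show ?case
    by (rule const[of "\<lambda>_ _. 0"]) (auto intro: polynomial_of_degree.intros)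
next
  case (inner n f b)
  from inner.IH obtain f' where f': "\<And>y. (f has_derivative f' y) (at y)" "\<And>v. polynomial_of_degree n (\<lambda>y. f' y v)"
    by blast
  show ?case
  proof (rule inner.prems)
    show "((\<lambda>y. (y \<bullet> b) * f y) has_derivative (\<lambda>v. (v \<bullet> b) * f y + (y \<bullet> b) * f' y v)) (at y)" for y
      by (auto intro!: derivative_eq_intros f')
    show "polynomial_of_degree (Suc n) (\<lambda>y. (v \<bullet> b) * f y + (y \<bullet> b) * f' y v)" for v
      by (intro polynomial_of_degree.add polynomial_of_degree.inner polynomial_of_degree_Suc
          polynomial_of_degree_scale inner.hyps f')
  qed
next
  case (add n f g)
  from add.IH obtain f' g' where
    f': "\<And>y. (f has_derivative f' y) (at y)" "\<And>v. polynomial_of_degree n (\<lambda>y. f' y v)" and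
    g': "\<And>y. (g has_derivative g' y) (at y)" "\<And>v. polynomial_of_degree n (\<lambda>y. g' y v)"
    by metis
  show ?case
    by (rule add.prems[of "\<lambda>y v. f' y v + g' y v"])
       (auto intro!: has_derivative_add polynomial_of_degree.add f' g')
qed

lemma polynomial_of_degree_bound:
  assumes "polynomial_of_degree n f"
  obtains C where "C \<ge> 0" "\<And>y. \<bar>f y\<bar> \<le> C * (1 + norm y) ^ n"
  using assms
proof (induction arbitrary: thesis rule: polynomial_of_degree.induct)
  case (const n c)
  show ?case
    by (rule const[of "\<bar>c\<bar>"]) (auto simp: mult_le_cancel_left1)
next
  case (inner n f b)
  from inner.IH obtain C where C: "C \<ge> 0" "\<And>y. \<bar>f y\<bar> \<le> C * (1 + norm y) ^ n"
    by blast
  show ?case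
  proof (rule inner.prems)
    show "\<bar>(y \<bullet> b) * f y\<bar> \<le> (norm b * C) * (1 + norm y) ^ Suc n" for y
    proof -
      have "\<bar>(y \<bullet> b) * f y\<bar> \<le> (norm y * norm b) * (C * (1 + norm y) ^ n)"
        unfolding abs_mult by (intro mult_mono C Cauchy_Schwarz_ineq2) auto
      also have "\<dots> \<le> ((1 + norm y) * norm b) * (C * (1 + norm y) ^ n)"
        using C by (intro mult_right_mono) auto
      finally show ?thesis by (simp add: mult_ac)
    qed
  qed (use C in auto)
next
  case (add n f g)
  from add.IH obtain C D where C: "C \<ge> 0" "\<And>y. \<bar>f y\<bar> \<le> C * (1 + norm y) ^ n"
    and D: "D \<ge> 0" "\<And>y. \<bar>g y\<bar> \<le> D * (1 + norm y) ^ n"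
    by metis
  show ?case
  proof (rule add.prems)
    show "\<bar>f y + g y\<bar> \<le> (C + D) * (1 + norm y) ^ n" for y
      using C(2)[of y] D(2)[of y] unfolding distrib_right by linarith
  qed (use C D in auto)
qed

text \<open>
  The bound \<open>2 * m\<close> on the degree keeps the functions bounded, and differentiation preserves it: a
  derivative falling on \<open>inverse_power_sum a m (y \<bullet> y)\<close> increases the degree by one and \<open>m\<close> by one.
\<close>

inductive_set radial_symbols :: "real \<Rightarrow> ('a::euclidean_space \<Rightarrow> real) set" for a where
  base: "polynomial_of_degree (2 * m) f \<Longrightarrow> (\<lambda>y. f y * inverse_power_sum a m (y \<bullet> y)) \<in> radial_symbols a"
| add: "f \<in> radial_symbols a \<Longrightarrow> g \<in> radial_symbols a \<Longrightarrow> (\<lambda>y. f y + g y) \<in> radial_symbols a"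

text \<open>As \<open>y \<bullet> y\<close> never leaves \<open>{0..}\<close>, the one-sided
  derivative of the sum at 0 suffices for an ordinary derivative at every y, the origin
  included.\<close>

lemma has_derivative_inverse_power_sum_inner:
  assumes "a > 0"
  shows "((\<lambda>y. inverse_power_sum a m (y \<bullet> y)) has_derivative
    (\<lambda>v. - 2 * real (Suc m) * (y \<bullet> v) * inverse_power_sum a (Suc m) (y \<bullet> y))) (at y)"
proof -
  have "((\<lambda>y. y \<bullet> y) has_derivative (\<lambda>v. 2 * (y \<bullet> v))) (at y)"
    by (auto intro!: derivative_eq_intros simp: inner_commute)
  moreover have "(inverse_power_sum a m has_derivative (*) (- real (Suc m) * inverse_power_sum a (Suc m) u))
     (at u within {0..})" if "u \<ge> 0" for u
    using that has_field_derivative_inverse_power_sum[OF assms] by (auto simp: has_field_derivative_def)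
  ultimately have "((\<lambda>y. inverse_power_sum a m (y \<bullet> y)) has_derivative
      (\<lambda>v. - real (Suc m) * inverse_power_sum a (Suc m) (y \<bullet> y) * (2 * (y \<bullet> v)))) (at y)"
    by (intro has_derivative_in_compose2[of "{0..}" "inverse_power_sum a m" _ "\<lambda>y. y \<bullet> y" UNIV]) auto
  then show ?thesis
    by (rule has_derivative_eq_rhs) (simp add: fun_eq_iff)
qed

lemma differentiation_closed_radial_symbols:
  assumes "a > 0"
  shows "differentiation_closed (radial_symbols a)"
  unfolding differentiation_closed_def
proof
  fix f :: "'a \<Rightarrow> real" assume "f \<in> radial_symbols a"
  then show "\<exists>f'. (\<forall>y. (f has_derivative f' y) (at y)) \<and> (\<forall>v. (\<lambda>y. f' y v) \<in> radial_symbols a)"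
  proof induction
    case (base m f)
    obtain f' where f': "\<And>y. (f has_derivative f' y) (at y)" "\<And>v. polynomial_of_degree (2 * m) (\<lambda>y. f' y v)"
      using polynomial_of_degree_has_derivative[OF base] by blast
    let ?D = "\<lambda>y v. f' y v * inverse_power_sum a m (y \<bullet> y)
      + (- 2 * real (Suc m) * ((y \<bullet> v) * f y)) * inverse_power_sum a (Suc m) (y \<bullet> y)"
    have "((\<lambda>y. f y * inverse_power_sum a m (y \<bullet> y)) has_derivative ?D y) (at y)" for y
      by (rule has_derivative_eq_rhs[OF has_derivative_mult[OF f'(1) has_derivative_inverse_power_sum_inner[OF assms]]])
         (simp add: fun_eq_iff algebra_simps)
    moreover have "(\<lambda>y. ?D y v) \<in> radial_symbols a" for v
    proof -
      \<comment> \<open>The factor \<open>y \<bullet> v\<close> raises the degree to 2 m + 1; one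
        more is granted to reach the even bound that goes with \<open>Suc m\<close>.\<close>
      have "polynomial_of_degree (2 * Suc m) (\<lambda>y. - 2 * real (Suc m) * ((y \<bullet> v) * f y))"
        using polynomial_of_degree_scale[OF polynomial_of_degree_Suc[OF polynomial_of_degree.inner[OF base]]]
        by simp
      then show ?thesis
        by (intro radial_symbols.add radial_symbols.base f')
    qed
    ultimately show ?case
      by (intro exI[of _ ?D]) blast
  next
    case (add f g)
    then obtain f' g' where
      "\<And>y. (f has_derivative f' y) (at y)" "\<And>v. (\<lambda>y. f' y v) \<in> radial_symbols a"
      "\<And>y. (g has_derivative g' y) (at y)" "\<And>v. (\<lambda>y. g' y v) \<in> radial_symbols a"
      by metis
    then show ?case
      by (intro exI[of _ "\<lambda>y v. f' y v + g' y v"])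
         (auto intro!: has_derivative_add radial_symbols.add)
  qed
qed

lemma bounded_radial_symbols:
  assumes "a > 0" "f \<in> radial_symbols a"
  shows "bounded (range f)"
  using assms(2)
proof induction
  case (base m f)
  obtain C where C: "C \<ge> 0" "\<And>y. \<bar>f y\<bar> \<le> C * (1 + norm y) ^ (2 * m)"
    using polynomial_of_degree_bound[OF base] by blast
  obtain D where D: "\<And>u. u \<ge> 0 \<Longrightarrow> \<bar>inverse_power_sum a m u\<bar> * (1 + u) ^ m \<le> D"
    using inverse_power_sum_bounds[OF assms(1)] by metis
  have "\<bar>f y * inverse_power_sum a m (y \<bullet> y)\<bar> \<le> C * 2 ^ m * D" for y
  proof -
    \<comment> \<open>This turns the growth in |y| into the weight 1 + |y|^2 of
      \<open>inverse_power_sum_bounds\<close>, at the cost of a factor 2^m.\<close>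
    have "(1 + norm y)\<^sup>2 \<le> 2 * (1 + y \<bullet> y)"
      using sum_squares_bound[of 1 "norm y"] by (simp add: power2_eq_square algebra_simps flip: power2_norm_eq_inner)
    then have "(1 + norm y) ^ (2 * m) \<le> 2 ^ m * (1 + y \<bullet> y) ^ m"
      unfolding power_mult power_mult_distrib[symmetric] by (intro power_mono) auto
    then have "\<bar>f y\<bar> \<le> C * (2 ^ m * (1 + y \<bullet> y) ^ m)"
      using C by (meson mult_left_mono order_trans)
    then have "\<bar>f y * inverse_power_sum a m (y \<bullet> y)\<bar> \<le> C * (2 ^ m * (1 + y \<bullet> y) ^ m) * \<bar>inverse_power_sum a m (y \<bullet> y)\<bar>"
      unfolding abs_mult by (intro mult_right_mono) auto
    also have "\<dots> = C * 2 ^ m * (\<bar>inverse_power_sum a m (y \<bullet> y)\<bar> * (1 + y \<bullet> y) ^ m)"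
      by (simp add: mult_ac)
    also have "\<dots> \<le> C * 2 ^ m * D"
      using C D[of "y \<bullet> y"] by (intro mult_left_mono) auto
    finally show ?thesis .
  qed
  then show ?case
    by (auto simp: bounded_iff)
next
  case (add f g)
  show ?case
    by (intro bounded_plus_comp add.IH)
qed

section \<open>Smooth ramps\<close>

text \<open>The flat function exp (-1/x), extended by 0, and its quotients by powers of x, which are
  the terms that differentiation produces.\<close>

definition exp_flat :: "nat \<Rightarrow> real \<Rightarrow> real" where
  "exp_flat n x = (if x > 0 then exp (- (1 / x)) / x ^ n else 0)"

lemma exp_flat_tendsto_0: "(exp_flat n \<longlongrightarrow> 0) (at 0)"
proof -
  have "((\<lambda>x::real. inverse x ^ n / exp (inverse x)) \<longlongrightarrow> 0) (at_right 0)"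
    by (rule filterlim_compose[OF tendsto_power_div_exp_0 filterlim_inverse_at_top_right])
  then have "(exp_flat n \<longlongrightarrow> 0) (at_right 0)"
    by (rule Lim_transform_eventually)
       (auto simp: eventually_at_filter exp_flat_def exp_minus field_simps power_inverse)
  moreover have "(exp_flat n \<longlongrightarrow> 0) (at_left 0)"
    by (rule tendsto_eventually) (auto simp: eventually_at_filter exp_flat_def)
  ultimately show ?thesis
    by (simp add: filterlim_split_at)
qed

lemma exp_flat_has_field_derivative:
  "(exp_flat n has_field_derivative (exp_flat (n + 2) x - real n * exp_flat (n + 1) x)) (at x)"
proof (cases x "0::real" rule: linorder_cases)
  case less
  have "((\<lambda>_. 0) has_field_derivative (exp_flat (n + 2) x - real n * exp_flat (n + 1) x)) (at x)"
    using less by (simp add: exp_flat_def)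
  then show ?thesis
    by (rule has_field_derivative_transform_within_open[of _ _ _ "{..<0}"])
       (use less in \<open>auto simp: exp_flat_def\<close>)
next
  case equal
  \<comment> \<open>At the origin the difference quotient of \<open>exp_flat n\<close> is
    \<open>exp_flat (Suc n)\<close>, which tends to 0.\<close>
  have "((\<lambda>y. (exp_flat n y - exp_flat n 0) / (y - 0)) \<longlongrightarrow> 0) (at 0)"
    by (rule Lim_transform_eventually[OF exp_flat_tendsto_0[of "Suc n"]])
       (auto simp: eventually_at_filter exp_flat_def field_simps)
  then show ?thesis
    using equal by (simp add: has_field_derivative_iff exp_flat_def)
next
  case greater
  have "((\<lambda>x. exp (- (1 / x)) * inverse (x ^ n)) has_field_derivative
      exp (- (1 / x)) * (1 / x\<^sup>2) * inverse (x ^ n)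
      - exp (- (1 / x)) * (inverse (x ^ n) * (real n * x ^ (n - 1)) * inverse (x ^ n))) (at x)"
    using greater by (auto intro!: derivative_eq_intros simp: power2_eq_square)
  also have "exp (- (1 / x)) * (1 / x\<^sup>2) * inverse (x ^ n)
      - exp (- (1 / x)) * (inverse (x ^ n) * (real n * x ^ (n - 1)) * inverse (x ^ n))
      = exp_flat (n + 2) x - real n * exp_flat (n + 1) x"
    using greater by (cases n) (auto simp: exp_flat_def field_simps power2_eq_square)
  finally have "((\<lambda>x. exp (- (1 / x)) * inverse (x ^ n)) has_field_derivative
      (exp_flat (n + 2) x - real n * exp_flat (n + 1) x)) (at x)" .
  then show ?thesis
    by (rule has_field_derivative_transform_within_open[of _ _ _ "{0<..}"])
       (use greater in \<open>auto simp: exp_flat_def field_simps\<close>)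
qed

text \<open>For \<epsilon> > 0 each term is supported in [p, p + \<epsilon>]; n and m record the
  powers that differentiation piles up in the denominators at the two ends. The width is fixed, but
  p varies from term to term, as the derivative of a plateau lives on two intervals.\<close>

inductive_set bumps :: "real \<Rightarrow> (real \<Rightarrow> real) set" for \<epsilon> where
  base: "(\<lambda>x. c * (exp_flat n ((x - p) / \<epsilon>) * exp_flat m (1 - (x - p) / \<epsilon>))) \<in> bumps \<epsilon>"
| add: "f \<in> bumps \<epsilon> \<Longrightarrow> g \<in> bumps \<epsilon> \<Longrightarrow> (\<lambda>x. f x + g x) \<in> bumps \<epsilon>"

lemma differentiation_closed_bumps:
  assumes "\<epsilon> > 0"
  shows "differentiation_closed (bumps \<epsilon>)"
  unfolding differentiation_closed_def
proof
  fix f assume "f \<in> bumps \<epsilon>"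
  then show "\<exists>f'. (\<forall>y. (f has_derivative f' y) (at y)) \<and> (\<forall>v. (\<lambda>y. f' y v) \<in> bumps \<epsilon>)"
  proof induction
    case (base c n p m)
    let ?b = "\<lambda>c n m x. c * (exp_flat n ((x - p) / \<epsilon>) * exp_flat m (1 - (x - p) / \<epsilon>))"
    let ?D = "\<lambda>x v. (?b (c / \<epsilon> * v) (n + 2) m x + ?b (- (c / \<epsilon> * n * v)) (n + 1) m x)
      + (?b (- (c / \<epsilon> * v)) n (m + 2) x + ?b (c / \<epsilon> * m * v) n (m + 1) x)"
    have "(?b c n m has_derivative ?D x) (at x)" for x
    proof -
      have *: "((\<lambda>x. exp_flat n ((x - p) / \<epsilon>)) has_field_derivative
        (exp_flat (n + 2) ((x - p) / \<epsilon>) - real n * exp_flat (n + 1) ((x - p) / \<epsilon>)) * (1 / \<epsilon>)) (at x)"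
        by (rule DERIV_chain2[OF exp_flat_has_field_derivative]) (use assms in \<open>auto intro!: derivative_eq_intros\<close>)
      have **: "((\<lambda>x. exp_flat m (1 - (x - p) / \<epsilon>)) has_field_derivative
        (exp_flat (m + 2) (1 - (x - p) / \<epsilon>) - real m * exp_flat (m + 1) (1 - (x - p) / \<epsilon>)) * (- (1 / \<epsilon>))) (at x)"
        by (rule DERIV_chain2[OF exp_flat_has_field_derivative]) (use assms in \<open>auto intro!: derivative_eq_intros\<close>)
      from DERIV_cmult[OF DERIV_mult[OF * **], of c] show ?thesis
        unfolding has_field_derivative_def
        by (rule has_derivative_eq_rhs) (simp add: fun_eq_iff algebra_simps diff_divide_distrib)
    qed
    moreover have "(\<lambda>x. ?D x v) \<in> bumps \<epsilon>" for v
      by (intro bumps.add bumps.base)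
    ultimately show ?case
      by (intro exI[of _ ?D]) blast
  next
    case (add f g)
    then obtain f' g' where
      "\<And>y. (f has_derivative f' y) (at y)" "\<And>v. (\<lambda>y. f' y v) \<in> bumps \<epsilon>"
      "\<And>y. (g has_derivative g' y) (at y)" "\<And>v. (\<lambda>y. g' y v) \<in> bumps \<epsilon>"
      by metis
    then show ?case
      by (intro exI[of _ "\<lambda>y v. f' y v + g' y v"])
         (auto intro!: has_derivative_add bumps.add)
  qed
qed

definition bump :: "real \<Rightarrow> real" where
  "bump x = exp_flat 0 x * exp_flat 0 (1 - x)"

lemma bump_nonneg: "bump x \<ge> 0"
  by (simp add: bump_def exp_flat_def)

lemma bump_pos: "0 < x \<Longrightarrow> x < 1 \<Longrightarrow> bump x > 0"
  by (simp add: bump_def exp_flat_def)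

lemma bump_eq_0: "x \<le> 0 \<or> x \<ge> 1 \<Longrightarrow> bump x = 0"
  by (auto simp: bump_def exp_flat_def)

lemma isCont_bump: "isCont bump x"
proof -
  have e: "isCont (exp_flat 0) y" for y
    using exp_flat_has_field_derivative by (rule DERIV_isCont)
  have "isCont (\<lambda>x. exp_flat 0 (1 - x)) x"
    by (rule isCont_o2[OF _ e]) (intro continuous_intros)
  with e show ?thesis
    unfolding bump_def[abs_def] by (intro isCont_mult)
qed

text \<open>R is the antiderivative of \<open>bump\<close> vanishing at 0: constant where
  \<open>bump\<close> vanishes, monotone since \<open>bump\<close> is nonnegative. Its total rise I
  is not normalized; it cancels in \<open>weak_derivative_increment\<close>.\<close>

lemma bump_ramp:
  obtains R I where "I > 0" "\<And>x. (R has_real_derivative bump x) (at x)"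
    "\<And>x. x \<le> 0 \<Longrightarrow> R x = 0" "\<And>x. x \<ge> 1 \<Longrightarrow> R x = I" "\<And>x. 0 \<le> R x \<and> R x \<le> I"
    "(\<integral>x. bump x \<partial>lebesgue) = I" "integrable lebesgue bump"
proof -
  obtain G where G: "\<And>x. (G has_real_derivative bump x) (at x)"
    using einterval_antiderivative[of "-\<infinity>" "\<infinity>" bump] isCont_bump
    by (auto simp: has_real_derivative_iff_has_vector_derivative)
  define R where "R x = G x - G 0" for x
  have R: "(R has_real_derivative bump x) (at x)" for x
    unfolding R_def by (auto intro!: derivative_eq_intros G)
  have R0: "R x = 0" if le: "x \<le> 0" for x
  proof (cases "x = 0")
    case False
    then obtain z where "z < 0" "R 0 - R x = (0 - x) * bump z"
      using MVT2[of x 0 R bump] R le by auto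
    then show ?thesis
      by (simp add: bump_eq_0 R_def)
  qed (simp add: R_def)
  have R1: "R x = R 1" if ge: "x \<ge> 1" for x
  proof (cases "x = 1")
    case False
    then obtain z where "z > 1" "R x - R 1 = (x - 1) * bump z"
      using MVT2[of 1 x R bump] R ge by auto
    then show ?thesis
      by (simp add: bump_eq_0)
  qed simp
  have mono: "R x \<le> R y" if "x \<le> y" for x y
    using that R bump_nonneg by (intro DERIV_nonneg_imp_nondecreasing[of x y R]) blast+
  have bounds: "0 \<le> R x \<and> R x \<le> R 1" for x
    using mono[of x 1] mono[of 0 x] R0[of x] R0[of 0] R1[of x] mono[of 0 1]
    by (cases "x \<le> 0"; cases "x \<ge> 1") auto
  obtain z where "0 < z" "z < 1" "R 1 - R 0 = (1 - 0) * bump z"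
    using MVT2[of 0 1 R bump] R by auto
  then have "R 1 > 0"
    using bump_pos R0[of 0] by simp
  have hk: "(bump has_integral R 1) {0..1}"
    using fundamental_theorem_of_calculus[of 0 1 R bump] R R0[of 0]
    by (auto simp: has_real_derivative_iff_has_vector_derivative intro: has_vector_derivative_at_within)
  \<comment> \<open>Off the unit interval \<open>bump\<close> vanishes, so the integral over the
    line reduces to the fundamental theorem on \<open>{0..1}\<close>.\<close>
  have eq: "bump = (\<lambda>x. if x \<in> {0..1} then bump x else 0)"
    using bump_eq_0 by (force simp: fun_eq_iff)
  have "continuous_on {0..1} bump"
    by (rule continuous_at_imp_continuous_on) (simp add: isCont_bump)
  then have int: "integrable (lebesgue_on {0..1}) bump"
    by (rule continuous_imp_integrable_real)
  then have "integrable lebesgue bump"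
    using Lebesgue_Measure.integrable_restrict_UNIV[of "{0..1}" bump] by (subst eq) simp
  have "(\<integral>x. bump x \<partial>lebesgue) = (\<integral>x. bump x \<partial>lebesgue_on {0..1})"
    using Lebesgue_Measure.integral_restrict_UNIV[of "{0..1}" bump] by (subst eq) simp
  also have "\<dots> = R 1"
    using lebesgue_integral_eq_integral[OF int] hk by (simp add: integral_unique)
  finally have "(\<integral>x. bump x \<partial>lebesgue) = R 1" .
  with R R0 R1 bounds \<open>R 1 > 0\<close> \<open>integrable lebesgue bump\<close> show thesis
    using that[of "R 1" R] by blast
qed

text \<open>The first ramp switches on after a and the second cancels it after b, which leaves a
  function supported in [a, b + \<epsilon>] whose derivative is a difference of two scaled
  bumps.\<close>

lemma test_function_ramp:
  assumes R: "\<And>x. (R has_real_derivative bump x) (at x)" "\<And>x. x \<le> 0 \<Longrightarrow> R x = 0" "\<And>x. x \<ge> 1 \<Longrightarrow> R x = I"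
    and "A < a" "a < b" "b + \<epsilon> < B" "\<epsilon> > 0"
  defines "\<phi> \<equiv> (\<lambda>x. R ((x - a) / \<epsilon>) - R ((x - b) / \<epsilon>))"
  shows "test_function {A<..<B} \<phi>"
    and "partials [1] \<phi> = (\<lambda>x. (bump ((x - a) / \<epsilon>) - bump ((x - b) / \<epsilon>)) / \<epsilon>)"
proof -
  have D: "(\<phi> has_real_derivative (bump ((x - a) / \<epsilon>) - bump ((x - b) / \<epsilon>)) / \<epsilon>) (at x)" for x
  proof -
    have "((\<lambda>x. R ((x - c) / \<epsilon>)) has_real_derivative bump ((x - c) / \<epsilon>) * (1 / \<epsilon>)) (at x)" for c
      by (rule DERIV_chain2[OF R(1)]) (use \<open>\<epsilon> > 0\<close> in \<open>auto intro!: derivative_eq_intros\<close>)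
    from DERIV_diff[OF this this] show ?thesis
      unfolding \<phi>_def by (simp add: diff_divide_distrib)
  qed
  have "(\<lambda>x. v * (bump ((x - a) / \<epsilon>) - bump ((x - b) / \<epsilon>)) / \<epsilon>) \<in> bumps \<epsilon>" for v
  proof -
    have "(\<lambda>x. (v / \<epsilon>) * (exp_flat 0 ((x - a) / \<epsilon>) * exp_flat 0 (1 - (x - a) / \<epsilon>))
       + (- (v / \<epsilon>)) * (exp_flat 0 ((x - b) / \<epsilon>) * exp_flat 0 (1 - (x - b) / \<epsilon>))) \<in> bumps \<epsilon>"
      by (intro bumps.add bumps.base)
    then show ?thesis
      by (simp add: bump_def algebra_simps diff_divide_distrib)
  qed
  moreover have "(\<phi> has_derivative (\<lambda>v. v * (bump ((x - a) / \<epsilon>) - bump ((x - b) / \<epsilon>)) / \<epsilon>)) (at x)" for x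
    using D[of x] unfolding has_field_derivative_def
    by (rule has_derivative_eq_rhs) (simp add: fun_eq_iff)
  ultimately have "\<exists>f'. (\<forall>y. (\<phi> has_derivative f' y) (at y)) \<and> (\<forall>v. (\<lambda>y. f' y v) \<in> bumps \<epsilon>)"
    by (intro exI[of _ "\<lambda>x v. v * (bump ((x - a) / \<epsilon>) - bump ((x - b) / \<epsilon>)) / \<epsilon>"]) simp
  moreover have "bumps \<epsilon> \<subseteq> insert \<phi> (bumps \<epsilon>)"
    by blast
  \<comment> \<open>The function itself need not lie in \<open>bumps\<close>, but its derivatives
    do, so adjoining it keeps the class closed.\<close>
  ultimately have "differentiation_closed (insert \<phi> (bumps \<epsilon>))"
    using differentiation_closed_bumps[OF \<open>\<epsilon> > 0\<close>] unfolding differentiation_closed_def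
    by (metis insert_iff)
  then have "smooth_on UNIV \<phi>"
    by (rule smooth_on_differentiation_closed) simp
  moreover have "\<phi> x = 0" if "x \<notin> {a..b + \<epsilon>}" for x
  proof (cases "x < a")
    case True
    then show ?thesis
      using R(2) assms by (simp add: \<phi>_def field_simps)
  next
    case False
    then have "(x - a) / \<epsilon> \<ge> 1" "(x - b) / \<epsilon> \<ge> 1"
      using that assms by (auto simp: field_simps)
    then show ?thesis
      using R(3) by (simp add: \<phi>_def)
  qed
  ultimately show "test_function {A<..<B} \<phi>"
    unfolding test_function_def using assms by (intro conjI exI[of _ "{a..b + \<epsilon>}"]) auto
  show "partials [1] \<phi> = (\<lambda>x. (bump ((x - a) / \<epsilon>) - bump ((x - b) / \<epsilon>)) / \<epsilon>)"
    using frechet_derivative_at[OF D[unfolded has_field_derivative_def], symmetric] by simp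
qed

section \<open>Almost everywhere differentiability in one dimension\<close>

lemma L2_imp_integrable:
  assumes "S \<in> lmeasurable" "f \<in> L2 S"
  shows "integrable (lebesgue_on S) f"
proof (rule Bochner_Integration.integrable_bound)
  interpret finite_measure "lebesgue_on S"
    using assms(1) by (rule finite_measure_lebesgue_on)
  show "integrable (lebesgue_on S) (\<lambda>x. 1 + (f x)\<^sup>2)"
    using assms(2) by (intro Bochner_Integration.integrable_add integrable_const) (simp add: L2_def)
  show "AE x in lebesgue_on S. norm (f x) \<le> norm (1 + (f x)\<^sup>2)"
  proof (rule AE_I2)
    fix x
    show "norm (f x) \<le> norm (1 + (f x)\<^sup>2)"
      using sum_squares_bound[of 1 "\<bar>f x\<bar>"] by simp
  qed
qed (use assms in \<open>simp add: L2_def\<close>)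

text \<open>Substituting x = c + \<epsilon> y gives the integral of u (c + \<epsilon> y) times bump
  y, to which dominated convergence applies. The condition with d keeps these points in the compact
  interval [c, d], where u is bounded; near A or B it need not be.\<close>

lemma bump_mollification:
  fixes u :: "real \<Rightarrow> real"
  assumes u: "continuous_on {A<..<B} u" and c: "A < c" "d < B"
    and \<epsilon>: "\<And>k. 0 < \<epsilon> k" "\<And>k. c + \<epsilon> k \<le> d" "\<epsilon> \<longlonglongrightarrow> 0"
  defines "f \<equiv> (\<lambda>k x. u x * (bump ((x - c) / \<epsilon> k) / \<epsilon> k))"
  shows "integrable (lebesgue_on {A<..<B}) (f k)"
    and "(\<lambda>k. \<integral>x. f k x \<partial>lebesgue_on {A<..<B}) \<longlonglongrightarrow> u c * (\<integral>x. bump x \<partial>lebesgue)"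
proof -
  let ?S = "{A<..<B}"
  let ?U = "\<lambda>x. indicator ?S x *\<^sub>R u x"
  have cd: "c < d"
    using \<epsilon>(1,2)[of 0] by linarith
  have U[measurable]: "?U \<in> borel_measurable borel"
    by (rule borel_measurable_continuous_on_indicator[OF _ u]) simp
  have bump[measurable]: "bump \<in> borel_measurable borel"
    by (intro borel_measurable_continuous_onI continuous_at_imp_continuous_on ballI isCont_bump)
  have "compact (u ` {c..d})"
    by (intro compact_continuous_image continuous_on_subset[OF u]) (use c cd in auto)
  then have "\<exists>M. \<forall>x\<in>{c..d}. \<bar>u x\<bar> \<le> M"
    by (auto dest!: compact_imp_bounded simp: bounded_iff)
  then obtain M where M: "\<And>x. x \<in> {c..d} \<Longrightarrow> \<bar>u x\<bar> \<le> M"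
    by blast
  have M0: "M \<ge> 0"
    using M[of c] cd by fastforce
  have US: "indicator ?S x *\<^sub>R f k x = ?U x * (bump ((x - c) / \<epsilon> k) / \<epsilon> k)" for k x
    by (simp add: f_def)
  have bound: "\<bar>?U (c + \<epsilon> k * y) * bump y\<bar> \<le> M * bump y" for k y
  proof (cases "0 < y \<and> y < 1")
    case True
    then have "\<epsilon> k * y \<le> \<epsilon> k * 1"
      using \<epsilon>(1)[of k] by (intro mult_left_mono) auto
    moreover have "\<epsilon> k * y \<ge> 0"
      using True \<epsilon>(1)[of k] by simp
    ultimately have "c + \<epsilon> k * y \<in> {c..d}"
      using \<epsilon>(2)[of k] unfolding atLeastAtMost_iff by linarith
    then show ?thesis
      using M[of "c + \<epsilon> k * y"] M0 bump_nonneg[of y] c cd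
      by (auto simp: abs_mult intro!: mult_right_mono)
  next
    case False
    then show ?thesis
      using bump_eq_0[of y] by (auto simp: not_less)
  qed
  obtain R I where RI: "(\<integral>x. bump x \<partial>lebesgue) = I" "integrable lebesgue bump"
    by (rule bump_ramp)
  have M_int: "integrable lebesgue (\<lambda>y. M * bump y)"
    using RI(2) by simp
  have meas: "(\<lambda>y. ?U (c + \<epsilon> k * y) * bump y) \<in> borel_measurable lebesgue" for k
    by (rule measurable_completion) measurable
  have int: "integrable lebesgue (\<lambda>y. ?U (c + \<epsilon> k * y) * bump y)" for k
    by (rule Bochner_Integration.integrable_bound[OF M_int meas])
       (use bound M0 bump_nonneg in \<open>auto intro!: AE_I2\<close>)
  have affine: "has_bochner_integral lebesgue (\<lambda>x. indicator ?S x *\<^sub>R f k x) (\<integral>y. ?U (c + \<epsilon> k * y) * bump y \<partial>lebesgue)" for k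
  proof -
    let ?i = "\<integral>y. ?U (c + \<epsilon> k * y) * bump y \<partial>lebesgue"
    have "has_bochner_integral lebesgue (\<lambda>y. ?U (c + \<epsilon> k * y) * bump y / \<epsilon> k) (?i / \<epsilon> k)"
      using int by (intro has_bochner_integral_divide_zero has_bochner_integral_integrable)
    moreover have "?U (c + \<epsilon> k * y) * bump y / \<epsilon> k = indicator ?S (c + \<epsilon> k * y) *\<^sub>R f k (c + \<epsilon> k * y)" for y
      using \<epsilon>(1)[of k] by (simp add: f_def)
    moreover have "?i / \<epsilon> k = ?i /\<^sub>R \<bar>\<epsilon> k\<bar>"
      using \<epsilon>(1)[of k] by (simp add: divide_inverse)
    ultimately show ?thesis
      using \<epsilon>(1)[of k] by (subst has_bochner_integral_lebesgue_real_affine_iff[of "\<epsilon> k" _ _ c]) auto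
  qed
  from affine show "integrable (lebesgue_on ?S) (f k)"
    by (subst integrable_restrict_space) (auto simp: has_bochner_integral_iff)
  have "(\<lambda>k. \<integral>y. ?U (c + \<epsilon> k * y) * bump y \<partial>lebesgue) \<longlonglongrightarrow> (\<integral>y. u c * bump y \<partial>lebesgue)"
  proof (rule integral_dominated_convergence[OF _ meas M_int])
    show "(\<lambda>y. u c * bump y) \<in> borel_measurable lebesgue"
      by (rule measurable_completion) measurable
    show "AE y in lebesgue. (\<lambda>k. ?U (c + \<epsilon> k * y) * bump y) \<longlonglongrightarrow> u c * bump y"
    proof (rule AE_I2)
      fix y
      have "isCont u c"
        using u c cd by (simp add: continuous_on_eq_continuous_at)
      moreover have "(\<lambda>k. c + \<epsilon> k * y) \<longlonglongrightarrow> c"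
        using tendsto_add[OF tendsto_const tendsto_mult_left_zero[OF \<epsilon>(3)], of c y] by simp
      ultimately have "(\<lambda>k. u (c + \<epsilon> k * y)) \<longlonglongrightarrow> u c"
        by (rule isCont_tendsto_compose)
      moreover have "\<forall>\<^sub>F k in sequentially. c + \<epsilon> k * y \<in> ?S"
        using \<open>(\<lambda>k. c + \<epsilon> k * y) \<longlonglongrightarrow> c\<close> c cd by (intro topological_tendstoD) auto
      then have "\<forall>\<^sub>F k in sequentially. u (c + \<epsilon> k * y) = ?U (c + \<epsilon> k * y)"
        by eventually_elim simp
      ultimately have "(\<lambda>k. ?U (c + \<epsilon> k * y)) \<longlonglongrightarrow> u c"
        by (rule Lim_transform_eventually)
      then show "(\<lambda>k. ?U (c + \<epsilon> k * y) * bump y) \<longlonglongrightarrow> u c * bump y"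
        by (intro tendsto_mult tendsto_const)
    qed
    show "AE y in lebesgue. norm (?U (c + \<epsilon> k * y) * bump y) \<le> M * bump y" for k
      using bound by auto
  qed
  then show "(\<lambda>k. \<integral>x. f k x \<partial>lebesgue_on ?S) \<longlonglongrightarrow> u c * (\<integral>x. bump x \<partial>lebesgue)"
    using affine by (simp add: integral_restrict_space has_bochner_integral_iff)
qed

text \<open>
  The test functions are smooth ramps tending to a multiple of the indicator of \<open>{a<..b}\<close>; their
  derivatives are mollifiers concentrating at \<open>a\<close> and \<open>b\<close>.
\<close>

lemma weak_derivative_increment:
  fixes u v :: "real \<Rightarrow> real"
  assumes u: "continuous_on {A<..<B} u" and v: "v \<in> L2 {A<..<B}"
    and weak: "has_weak_partials {A<..<B} [1] u v"
    and ab: "A < a" "a < b" "b < B"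
  shows "u b - u a = (\<integral>x. indicator {a<..b} x * v x \<partial>lebesgue_on {A<..<B})"
proof -
  let ?S = "{A<..<B}"
  obtain R I where I: "I > 0" and R: "\<And>x. (R has_real_derivative bump x) (at x)"
      "\<And>x. x \<le> 0 \<Longrightarrow> R x = 0" "\<And>x. x \<ge> 1 \<Longrightarrow> R x = I" "\<And>x. 0 \<le> R x \<and> R x \<le> I"
      and int: "(\<integral>x. bump x \<partial>lebesgue) = I"
    by (rule bump_ramp) blast
  \<comment> \<open>Half of this d is small enough for both ramps: a + \<epsilon> is at most b, and
    b + \<epsilon> stays below B by a fixed margin.\<close>
  define d where "d = min (b - a) (B - b)"
  define \<epsilon> where "\<epsilon> k = d / 2 / real (Suc k)" for k
  have d: "d > 0" "d \<le> b - a" "d \<le> B - b"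
    using ab by (auto simp: d_def)
  have \<epsilon>: "\<epsilon> k > 0" "\<epsilon> k \<le> d / 2" for k
    using d by (auto simp: \<epsilon>_def divide_le_eq mult_le_cancel_left1)
  have \<epsilon>0: "\<epsilon> \<longlonglongrightarrow> 0"
    unfolding \<epsilon>_def[abs_def] by (rule LIMSEQ_Suc[OF lim_const_over_n])
  define \<phi> where "\<phi> k = (\<lambda>x. R ((x - a) / \<epsilon> k) - R ((x - b) / \<epsilon> k))" for k
  let ?f = "\<lambda>c k x. u x * (bump ((x - c) / \<epsilon> k) / \<epsilon> k)"
  have le: "a + \<epsilon> k \<le> b" "b + \<epsilon> k \<le> b + d / 2" for k
    using \<epsilon>[of k] d by auto
  have bB: "b + d / 2 < B"
    using d by auto
  note moll_a = bump_mollification[OF u ab(1) ab(3) \<epsilon>(1) le(1) \<epsilon>0]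
  have Ab: "A < b" using ab by simp
  note moll_b = bump_mollification[OF u Ab bB \<epsilon>(1) le(2) \<epsilon>0]
  have eq: "(\<integral>x. v x * \<phi> k x \<partial>lebesgue_on ?S)
      = (\<integral>x. ?f b k x \<partial>lebesgue_on ?S) - (\<integral>x. ?f a k x \<partial>lebesgue_on ?S)" for k
  proof -
    have bk: "b + \<epsilon> k < B"
      using \<epsilon>[of k] bB by simp
    note test = test_function_ramp[where R = R and I = I, OF R(1-3) ab(1,2) bk \<epsilon>(1), folded \<phi>_def]
    have "L2_inner ?S u (partials [1] (\<phi> k)) = (-1) ^ length [1::real] * L2_inner ?S v (\<phi> k)"
      using weak test(1) unfolding has_weak_partials_def by blast
    moreover have "partials [1] (\<phi> k) = (\<lambda>x. (bump ((x - a) / \<epsilon> k) - bump ((x - b) / \<epsilon> k)) / \<epsilon> k)"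
      by (rule test(2))
    ultimately have "(\<integral>x. v x * \<phi> k x \<partial>lebesgue_on ?S)
        = - (\<integral>x. u x * ((bump ((x - a) / \<epsilon> k) - bump ((x - b) / \<epsilon> k)) / \<epsilon> k) \<partial>lebesgue_on ?S)"
      by (simp only: L2_inner_def) simp
    also have "(\<lambda>x. u x * ((bump ((x - a) / \<epsilon> k) - bump ((x - b) / \<epsilon> k)) / \<epsilon> k)) = (\<lambda>x. ?f a k x - ?f b k x)"
      by (simp add: fun_eq_iff diff_divide_distrib right_diff_distrib)
    also have "- (\<integral>x. ?f a k x - ?f b k x \<partial>lebesgue_on ?S) =
      (\<integral>x. ?f b k x \<partial>lebesgue_on ?S) - (\<integral>x. ?f a k x \<partial>lebesgue_on ?S)"
      by (subst Bochner_Integration.integral_diff[OF moll_a(1) moll_b(1)]) simp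
    finally show ?thesis .
  qed
  have v_int: "integrable (lebesgue_on ?S) v"
    by (rule L2_imp_integrable[OF _ v]) simp
  have [measurable]: "v \<in> borel_measurable (lebesgue_on ?S)"
    using v by (simp add: L2_def)
  have R_meas: "R \<in> borel_measurable borel"
    by (intro borel_measurable_continuous_onI continuous_at_imp_continuous_on ballI DERIV_isCont[OF R(1)])
  have "(\<lambda>k. \<integral>x. v x * \<phi> k x \<partial>lebesgue_on ?S) \<longlonglongrightarrow> (\<integral>x. v x * (I * indicator {a<..b} x) \<partial>lebesgue_on ?S)"
  proof (rule integral_dominated_convergence[where w = "\<lambda>x. I * \<bar>v x\<bar>"])
    show "integrable (lebesgue_on ?S) (\<lambda>x. I * \<bar>v x\<bar>)"
      using v_int by simp
    show "(\<lambda>x. v x * (I * indicator {a<..b} x)) \<in> borel_measurable (lebesgue_on ?S)"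
    proof (intro borel_measurable_times borel_measurable_const)
      show "indicat_real {a<..b} \<in> borel_measurable (lebesgue_on ?S)"
        by (intro measurable_restrict_space1 measurable_completion) simp
    qed measurable
    show "(\<lambda>x. v x * \<phi> k x) \<in> borel_measurable (lebesgue_on ?S)" for k
    proof (rule borel_measurable_times)
      show "\<phi> k \<in> borel_measurable (lebesgue_on ?S)"
        unfolding \<phi>_def using R_meas
        by (intro measurable_restrict_space1 measurable_completion) (simp, measurable)
    qed measurable
    show "AE x in lebesgue_on ?S. norm (v x * \<phi> k x) \<le> I * \<bar>v x\<bar>" for k
    proof (rule AE_I2)
      fix x
      have "\<bar>\<phi> k x\<bar> \<le> I"
        using R(4)[of "(x - a) / \<epsilon> k"] R(4)[of "(x - b) / \<epsilon> k"] unfolding \<phi>_def by linarith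
      then show "norm (v x * \<phi> k x) \<le> I * \<bar>v x\<bar>"
        using mult_left_mono[of "\<bar>\<phi> k x\<bar>" I "\<bar>v x\<bar>"] by (simp add: abs_mult mult.commute)
    qed
    show "AE x in lebesgue_on ?S. (\<lambda>k. v x * \<phi> k x) \<longlonglongrightarrow> v x * (I * indicator {a<..b} x)"
    proof (rule AE_I2)
      fix x
      \<comment> \<open>As \<epsilon> shrinks, the ramp at c is eventually I at every x > c and is
        always 0 at every x \<le> c, the point c included; hence the half-open interval in the
        limit.\<close>
      have lim: "(\<lambda>k. R ((x - c) / \<epsilon> k)) \<longlonglongrightarrow> I * indicator {c<..} x" for c
      proof (cases "x > c")
        case True
        then have "\<forall>\<^sub>F k in sequentially. \<epsilon> k < x - c"
          using order_tendstoD(2)[OF \<epsilon>0, of "x - c"] by simp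
        then have "\<forall>\<^sub>F k in sequentially. R ((x - c) / \<epsilon> k) = I"
          by eventually_elim (use \<epsilon> R(3) in \<open>simp add: field_simps\<close>)
        then show ?thesis
          using True by (simp add: tendsto_eventually)
      next
        case False
        then have "R ((x - c) / \<epsilon> k) = 0" for k
          using R(2) \<epsilon>(1)[of k] by (simp add: divide_le_0_iff)
        then show ?thesis
          using False by simp
      qed
      have "\<phi> k x = R ((x - a) / \<epsilon> k) - R ((x - b) / \<epsilon> k)" for k
        by (simp add: \<phi>_def)
      moreover have "indicat_real {a<..b} x = indicat_real {a<..} x - indicat_real {b<..} x"
        using ab by (auto simp: indicator_def)
      ultimately show "(\<lambda>k. v x * \<phi> k x) \<longlonglongrightarrow> v x * (I * indicator {a<..b} x)"
        using tendsto_mult[OF tendsto_const[of "v x"] tendsto_diff[OF lim[of a] lim[of b]]]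
        by (simp add: right_diff_distrib)
    qed
  qed
  moreover have "(\<lambda>k. \<integral>x. v x * \<phi> k x \<partial>lebesgue_on ?S) \<longlonglongrightarrow> u b * I - u a * I"
    unfolding eq using tendsto_diff[OF moll_b(2) moll_a(2)] by (simp add: int)
  ultimately have "(\<integral>x. v x * (I * indicator {a<..b} x) \<partial>lebesgue_on ?S) = u b * I - u a * I"
    by (rule LIMSEQ_unique)
  moreover have "(\<integral>x. v x * (I * indicator {a<..b} x) \<partial>lebesgue_on ?S)
      = I * (\<integral>x. indicator {a<..b} x * v x \<partial>lebesgue_on ?S)"
    by (subst integral_mult_right_zero[symmetric]) (simp add: mult_ac)
  ultimately have "I * (u b - u a) = I * (\<integral>x. indicator {a<..b} x * v x \<partial>lebesgue_on ?S)"
    by (simp add: algebra_simps)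
  then show ?thesis
    using I by simp
qed

text \<open>Lebesgue's differentiation theorem for the intervals [x, x + k]. These lie to the right
  of x; left derivatives will come from the reflected function.\<close>

lemma indefinite_integral_right_derivative:
  fixes f :: "real \<Rightarrow> real"
  assumes "\<And>a b. f integrable_on {a..b}"
  obtains N where "negligible N"
    "\<And>x. x \<notin> N \<Longrightarrow> ((\<lambda>k. integral {x..x + k} f / k) \<longlongrightarrow> f x) (at_right 0)"
proof -
  have "f integrable_on cbox a b" for a b
    using assms by (simp add: box_real)
  then obtain N where "negligible N" and N: "\<And>x e. x \<notin> N \<Longrightarrow> 0 < e \<Longrightarrow>
      \<exists>d>0. \<forall>k. 0 < k \<and> k < d \<longrightarrow> norm (integral (cbox x (x + k *\<^sub>R One)) f /\<^sub>R k ^ DIM(real) - f x) < e"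
    by (rule integrable_ccontinuous_explicit) metis
  moreover have "((\<lambda>k. integral {x..x + k} f / k) \<longlongrightarrow> f x) (at_right 0)" if "x \<notin> N" for x
  proof (rule tendstoI)
    fix e :: real assume "e > 0"
    from N[OF that this] show "\<forall>\<^sub>F k in at_right 0. dist (integral {x..x + k} f / k) (f x) < e"
      by (auto simp: eventually_at_right_field dist_norm divide_inverse mult.commute box_real)
  qed
  ultimately show thesis
    using that by blast
qed

text \<open>By \<open>weak_derivative_increment\<close> a continuous u is an indefinite integral of
  its weak derivative v. Lebesgue's theorem then gives the derivative almost everywhere, and the L^1
  norm of v bounds all increments, hence u.\<close>

lemma sobolev_real_AE_derivative:
  fixes u :: "real \<Rightarrow> real"
  assumes "u \<in> sobolev s {A<..<B}" "s \<ge> 1" "continuous_on {A<..<B} u" "A < B"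
  obtains v N where "v \<in> L2 {A<..<B}" "negligible N"
    "\<And>t. t \<in> {A<..<B} - N \<Longrightarrow> (u has_real_derivative v t) (at t)" "bounded (u ` {A<..<B})"
proof -
  let ?S = "{A<..<B}"
  have "[1::real] \<in> lists Basis" "length [1::real] \<le> nat \<lfloor>s\<rfloor>"
    using assms(2) by (simp_all add: le_nat_floor)
  then obtain v where v: "v \<in> L2 ?S" and weak: "has_weak_partials ?S [1] u v"
    using assms(1) unfolding sobolev_def by blast
  note incr = weak_derivative_increment[OF assms(3) v weak]
  have v_int: "integrable (lebesgue_on ?S) v"
    by (rule L2_imp_integrable[OF _ v]) simp
  \<comment> \<open>Extension by 0 makes w integrable over every interval, as
    \<open>indefinite_integral_right_derivative\<close> demands.\<close>
  define w where "w x = (if x \<in> ?S then v x else 0)" for x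
  have w_int: "integrable lebesgue w"
    using v_int Lebesgue_Measure.integrable_restrict_UNIV[of ?S v] unfolding w_def[abs_def] by simp
  have w_on: "integrable (lebesgue_on {a..b}) w" for a b
    by (subst integrable_restrict_space) (auto intro: integrable_mult_indicator[OF _ w_int, simplified])
  have increment: "integral {a..b} w = u b - u a" if "A < a" "a \<le> b" "b < B" for a b
  proof (cases "a = b")
    case False
    have "u b - u a = (\<integral>x. indicator {a<..b} x * v x \<partial>lebesgue_on ?S)"
      using that False by (intro incr) auto
    also have "\<dots> = (\<integral>x. indicator {a<..b} x *\<^sub>R w x \<partial>lebesgue)"
      by (subst integral_restrict_space) (auto intro!: Bochner_Integration.integral_cong simp: w_def indicator_def)
    also have "\<dots> = (\<integral>x. indicator {a..b} x *\<^sub>R w x \<partial>lebesgue)"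
    proof (rule integral_cong_AE)
      have "AE x in lebesgue. x \<noteq> a"
        by (rule AE_completion) (rule AE_lborel_singleton)
      then show "AE x in lebesgue. indicator {a<..b} x *\<^sub>R w x = indicator {a..b} x *\<^sub>R w x"
        by eventually_elim (auto simp: indicator_def)
    qed (use w_int in \<open>auto intro!: borel_measurable_times borel_measurable_indicator
          dest: borel_measurable_integrable\<close>)
    also have "\<dots> = (\<integral>x. w x \<partial>lebesgue_on {a..b})"
      by (subst integral_restrict_space) auto
    also have "\<dots> = integral {a..b} w"
      by (intro lebesgue_integral_eq_integral w_on) auto
    finally show ?thesis by simp
  qed simp
  have w_hk: "w integrable_on {a..b}" for a b
    by (intro integrable_on_lebesgue_on w_on) auto
  have w_hk': "(\<lambda>x. w (- x)) integrable_on {a..b}" for a b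
    using w_hk[of "-b" "-a"] Henstock_Kurzweil_Integration.integrable_reflect_real[where f = w and a = "-b" and b = "-a"]
    by (simp only: minus_minus)
  obtain N1 where "negligible N1" and
    N1: "\<And>x. x \<notin> N1 \<Longrightarrow> ((\<lambda>k. integral {x..x + k} w / k) \<longlongrightarrow> w x) (at_right 0)"
    using indefinite_integral_right_derivative[of w] w_hk by blast
  \<comment> \<open>Right difference quotients for the reflection at - t are left difference
    quotients of u at t, so the reflected null set has to be excluded as well.\<close>
  obtain N2 where "negligible N2" and
    N2: "\<And>x. x \<notin> N2 \<Longrightarrow> ((\<lambda>k. integral {x..x + k} (\<lambda>x. w (- x)) / k) \<longlongrightarrow> w (- x)) (at_right 0)"
    using indefinite_integral_right_derivative[of "\<lambda>x. w (- x)"] w_hk' by blast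
  have "(u has_real_derivative v t) (at t)" if t: "t \<in> ?S - (N1 \<union> uminus ` N2)" for t
  proof -
    have "- t \<notin> N2"
      using t by force
    have wt: "w t = v t"
      using t by (simp add: w_def)
    have "\<forall>\<^sub>F k in at_right 0. k < B - t" "\<forall>\<^sub>F k in at_right 0. k < t - A"
      using t by (auto intro!: order_tendstoD(2)[OF tendsto_ident_at])
    then have "\<forall>\<^sub>F k in at_right 0. 0 < k \<and> k < B - t \<and> k < t - A"
      using eventually_at_right_less[of "0::real"] by eventually_elim simp
    note ev = this
    have "((\<lambda>k. (u (t + k) - u t) / k) \<longlongrightarrow> v t) (at_right 0)"
    proof (rule Lim_transform_eventually)
      show "((\<lambda>k. integral {t..t + k} w / k) \<longlongrightarrow> v t) (at_right 0)"
        using N1[of t] t wt by simp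
      show "\<forall>\<^sub>F k in at_right 0. integral {t..t + k} w / k = (u (t + k) - u t) / k"
        using ev by eventually_elim (use t increment in auto)
    qed
    moreover have "((\<lambda>k. (u (t + k) - u t) / k) \<longlongrightarrow> v t) (at_left 0)"
      unfolding at_left_minus[of 0] filterlim_filtermap minus_zero
    proof (rule Lim_transform_eventually)
      show "((\<lambda>k. integral {- t..- t + k} (\<lambda>x. w (- x)) / k) \<longlongrightarrow> v t) (at_right 0)"
        using N2[OF \<open>- t \<notin> N2\<close>] wt by simp
      show "\<forall>\<^sub>F k in at_right 0. integral {- t..- t + k} (\<lambda>x. w (- x)) / k = (u (t + - k) - u t) / - k"
        using ev
      proof eventually_elim
        case (elim k)
        have "integral {- t..- (t - k)} (\<lambda>x. w (- x)) = integral {t - k..t} w"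
          using Henstock_Kurzweil_Integration.integral_reflect_real[where f = w and a = "t - k" and b = t]
          by simp
        also have "\<dots> = u t - u (t - k)"
          using elim t by (intro increment) auto
        finally have "integral {- t..- t + k} (\<lambda>x. w (- x)) = u t - u (t - k)"
          by (simp add: algebra_simps)
        then show ?case
          by (simp add: divide_simps)
      qed
    qed
    ultimately show ?thesis
      by (simp add: DERIV_def filterlim_split_at)
  qed
  moreover have "negligible (N1 \<union> uminus ` N2)"
  proof -
    have "negligible (uminus ` N2)"
      using \<open>negligible N2\<close>
      by (rule negligible_differentiable_image_negligible[OF order_refl])
        (auto intro!: differentiable_on_minus differentiable_on_ident)
    then show ?thesis
      using \<open>negligible N1\<close> by (rule negligible_Un[rotated])
  qed
  moreover have "bounded (u ` ?S)"
  proof -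
    define c where "c = (A + B) / 2"
    have c: "c \<in> ?S"
      using assms(4) by (simp add: c_def field_simps)
    let ?W = "\<integral>x. \<bar>w x\<bar> \<partial>lebesgue"
    have incr_le: "\<bar>u b - u a\<bar> \<le> ?W" if "A < a" "a \<le> b" "b < B" for a b
    proof -
      have "u b - u a = (\<integral>x. w x \<partial>lebesgue_on {a..b})"
        using increment[OF that] lebesgue_integral_eq_integral[OF w_on] by simp
      also have "\<bar>\<dots>\<bar> \<le> (\<integral>x. \<bar>w x\<bar> \<partial>lebesgue_on {a..b})"
        using integral_norm_bound[of "lebesgue_on {a..b}" w] by simp
      also have "\<dots> = (\<integral>x. indicator {a..b} x *\<^sub>R \<bar>w x\<bar> \<partial>lebesgue)"
        by (subst integral_restrict_space) auto
      also have "\<dots> \<le> ?W"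
      proof (rule integral_mono)
        show "integrable lebesgue (\<lambda>x. indicator {a..b} x *\<^sub>R \<bar>w x\<bar>)"
          by (intro integrable_mult_indicator integrable_abs w_int) auto
      qed (use w_int in \<open>auto simp: indicator_def\<close>)
      finally show ?thesis .
    qed
    have "\<bar>u t\<bar> \<le> \<bar>u c\<bar> + ?W" if "t \<in> ?S" for t
    proof (cases "t \<le> c")
      case True
      then show ?thesis
        using incr_le[of t c] that c by auto
    next
      case False
      then show ?thesis
        using incr_le[of c t] that c by auto
    qed
    then show ?thesis
      by (intro boundedI[of _ "\<bar>u c\<bar> + ?W"]) auto
  qed
  ultimately show thesis
    using that v by blast
qed

section \<open>Singular values and orthogonality constraints\<close>

text \<open>Gaussian elimination by induction on the equations: if equation a is not void, it
  expresses one unknown k through the others, which leaves one equation and one unknown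
  fewer.\<close>

lemma homogeneous_system_nontrivial_solution:
  fixes M :: "'b \<Rightarrow> 'i \<Rightarrow> real"
  assumes "finite A" "finite I" "card A < card I"
  obtains c where "\<exists>i\<in>I. c i \<noteq> 0" "\<And>a. a \<in> A \<Longrightarrow> (\<Sum>i\<in>I. c i * M a i) = 0"
  using assms
proof (induction A arbitrary: I M thesis rule: finite_induct)
  case empty
  then have "I \<noteq> {}" by auto
  then show ?case
    by (intro empty.prems(1)[of "\<lambda>_. 1"]) auto
next
  case (insert a A)
  show ?case
  proof (cases "\<forall>i\<in>I. M a i = 0")
    case True
    obtain c where "\<exists>i\<in>I. c i \<noteq> 0" "\<And>b. b \<in> A \<Longrightarrow> (\<Sum>i\<in>I. c i * M b i) = 0"
      using insert.IH[of I M] insert.prems insert.hyps by auto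
    with True show ?thesis
      by (intro insert.prems(1)[of c]) auto
  next
    case False
    then obtain k where k: "k \<in> I" "M a k \<noteq> 0" by blast
    let ?J = "I - {k}"
    have "card A < card ?J"
      using insert.prems insert.hyps k by auto
    then obtain c where c: "\<exists>i\<in>?J. c i \<noteq> 0"
      "\<And>b. b \<in> A \<Longrightarrow> (\<Sum>i\<in>?J. c i * (M b i - M b k * M a i / M a k)) = 0"
      using insert.IH[of ?J "\<lambda>b i. M b i - M b k * M a i / M a k"] insert.prems by auto
    define s where "s = (\<Sum>i\<in>?J. c i * M a i)"
    \<comment> \<open>This value at k solves equation a; the system handed to the induction
      hypothesis consists of the other equations after the same substitution.\<close>
    define c' where "c' = c(k := - s / M a k)"
    have sum: "(\<Sum>i\<in>I. c' i * M b i) = (\<Sum>i\<in>?J. c i * M b i) - s / M a k * M b k" for b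
    proof -
      have "(\<Sum>i\<in>I. c' i * M b i) = c' k * M b k + (\<Sum>i\<in>?J. c' i * M b i)"
        using insert.prems k by (intro sum.remove) auto
      also have "(\<Sum>i\<in>?J. c' i * M b i) = (\<Sum>i\<in>?J. c i * M b i)"
        by (intro sum.cong) (auto simp: c'_def)
      finally show ?thesis by (simp add: c'_def)
    qed
    show ?thesis
    proof (rule insert.prems(1))
      show "\<exists>i\<in>I. c' i \<noteq> 0"
        using c(1) by (auto simp: c'_def)
      fix b assume b: "b \<in> insert a A"
      show "(\<Sum>i\<in>I. c' i * M b i) = 0"
      proof (cases "b = a")
        case True
        then show ?thesis
          unfolding sum using k by (simp add: s_def)
      next
        case False
        have "s / M a k * M b k = (\<Sum>i\<in>?J. c i * (M b k * M a i / M a k))"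
          unfolding s_def by (simp add: sum_distrib_left sum_distrib_right sum_divide_distrib mult_ac)
        then show ?thesis
          using c(2)[of b] b False unfolding sum by (simp add: right_diff_distrib sum_subtractf)
      qed
    qed
  qed
qed

section \<open>Elementary properties of \<open>L2\<close>, and singular values under orthogonality
  constraints\<close>

lemma L2_product_integrable:
  assumes "f \<in> L2 S" "g \<in> L2 S"
  shows "integrable (lebesgue_on S) (\<lambda>x. f x * g x)"
proof (rule Bochner_Integration.integrable_bound)
  show "integrable (lebesgue_on S) (\<lambda>x. (f x)\<^sup>2 + (g x)\<^sup>2)"
    using assms by (intro Bochner_Integration.integrable_add) (auto simp: L2_def)
  show "(\<lambda>x. f x * g x) \<in> borel_measurable (lebesgue_on S)"
    using assms by (auto simp: L2_def)
  show "AE x in lebesgue_on S. norm (f x * g x) \<le> norm ((f x)\<^sup>2 + (g x)\<^sup>2)"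
  proof (rule AE_I2)
    fix x
    have "2 * \<bar>f x\<bar> * \<bar>g x\<bar> \<le> (f x)\<^sup>2 + (g x)\<^sup>2"
      using sum_squares_bound[of "\<bar>f x\<bar>" "\<bar>g x\<bar>"] by simp
    moreover have "0 \<le> \<bar>f x\<bar> * \<bar>g x\<bar>"
      by simp
    ultimately show "norm (f x * g x) \<le> norm ((f x)\<^sup>2 + (g x)\<^sup>2)"
      unfolding real_norm_def abs_mult by linarith
  qed
qed

lemma L2_add:
  assumes "f \<in> L2 S" "g \<in> L2 S"
  shows "(\<lambda>x. f x + g x) \<in> L2 S"
proof -
  have "integrable (lebesgue_on S) (\<lambda>x. (f x)\<^sup>2 + (g x)\<^sup>2 + 2 * (f x * g x))"
    using assms L2_product_integrable[OF assms]
    by (intro Bochner_Integration.integrable_add integrable_mult_right) (auto simp: L2_def)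
  then show ?thesis
    using assms by (auto simp: L2_def power2_sum algebra_simps)
qed

lemma L2_scale:
  assumes "f \<in> L2 S"
  shows "(\<lambda>x. c * f x) \<in> L2 S"
  using assms by (auto simp: L2_def power_mult_distrib)

lemma L2_sum:
  assumes "\<And>i. i \<in> I \<Longrightarrow> f i \<in> L2 S"
  shows "(\<lambda>x. \<Sum>i\<in>I. f i x) \<in> L2 S"
  using assms
proof (induction I rule: infinite_finite_induct)
  case (insert i I)
  then show ?case
    using L2_add[of "f i" S "\<lambda>x. \<Sum>i\<in>I. f i x"] by simp
qed (auto simp: L2_def)

lemma L2_inner_sum_left:
  assumes "\<And>i. i \<in> I \<Longrightarrow> f i \<in> L2 S" "g \<in> L2 S"
  shows "L2_inner S (\<lambda>x. \<Sum>i\<in>I. c i * f i x) g = (\<Sum>i\<in>I. c i * L2_inner S (f i) g)"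
proof -
  have "(\<lambda>x. (\<Sum>i\<in>I. c i * f i x) * g x) = (\<lambda>x. \<Sum>i\<in>I. c i * (f i x * g x))"
    by (simp add: sum_distrib_right mult.assoc)
  then show ?thesis
    unfolding L2_inner_def using assms by (simp add: L2_product_integrable)
qed

lemma L2_inner_commute: "L2_inner S f g = L2_inner S g f"
  by (simp add: L2_inner_def mult.commute)

text \<open>The upper half of the min-max principle. Fewer than n constraints leave a unit vector w
  in the span of n orthonormal singular functions \<open>u i\<close>, and if c i are its
  coefficients, |F w|^2 is the sum of (c i)^2 (\<tau> i)^2, hence at least \<mu>^2. Linearity is
  asked almost everywhere because the kernel is controlled only outside a null set of times.\<close>

lemma singular_value_le:
  fixes F :: "('a::euclidean_space \<Rightarrow> real) \<Rightarrow> 'b::euclidean_space \<Rightarrow> real"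
  assumes S': "S' \<in> sets lebesgue"
    and F_L2: "\<And>f. f \<in> L2 S \<Longrightarrow> F f \<in> L2 S'"
    and F_linear: "\<And>(u :: nat \<Rightarrow> 'a \<Rightarrow> real) c n. (\<And>i. i < n \<Longrightarrow> u i \<in> L2 S) \<Longrightarrow>
      AE t in lebesgue_on S'. F (\<lambda>x. \<Sum>i<n. c i * u i x) t = (\<Sum>i<n. c i * F (u i) t)"
    and A: "finite A" "card A < n" "A \<subseteq> L2 S"
    and bound: "\<And>u. u \<in> L2 S \<Longrightarrow> L2_inner S u u = 1 \<Longrightarrow> (\<And>a. a \<in> A \<Longrightarrow> L2_inner S u a = 0) \<Longrightarrow>
      L2_inner S' (F u) (F u) \<le> E\<^sup>2"
    and "E \<ge> 0"
  shows "singular_value S S' F n \<le> E"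
  unfolding singular_value_def
proof (rule cSup_least)
  fix \<mu> assume "\<mu> \<in> insert 0 {\<mu>. \<mu> > 0 \<and> (\<exists>(u :: nat \<Rightarrow> 'a \<Rightarrow> real) \<tau>.
        (\<forall>i<n. \<mu> \<le> \<tau> i \<and> singular_function S S' F (\<tau> i) (u i)) \<and>
        (\<forall>i<n. \<forall>j<n. L2_inner S (u i) (u j) = (if i = j then 1 else 0)))}"
  then consider "\<mu> = 0" | u \<tau> where "\<mu> > 0"
    "\<And>i. i < n \<Longrightarrow> \<mu> \<le> \<tau> i" "\<And>i. i < n \<Longrightarrow> singular_function S S' F (\<tau> i) (u i)"
    "\<And>i j. i < n \<Longrightarrow> j < n \<Longrightarrow> L2_inner S (u i) (u j) = (if i = j then 1 else 0)"
    by blast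
  then show "\<mu> \<le> E"
  proof cases
    case 2
    have u: "u i \<in> L2 S" if "i < n" for i
      using 2(3)[OF that] by (simp add: singular_function_def)
    obtain c0 where c0: "\<exists>i\<in>{..<n}. c0 i \<noteq> 0" "\<And>a. a \<in> A \<Longrightarrow> (\<Sum>i<n. c0 i * L2_inner S (u i) a) = 0"
      using homogeneous_system_nontrivial_solution[of A "{..<n}" "\<lambda>a i. L2_inner S (u i) a"] A by auto
    define s where "s = (\<Sum>i<n. (c0 i)\<^sup>2)"
    have "s > 0"
      using c0(1) unfolding s_def by (auto intro: sum_pos2)
    define c where "c i = c0 i / sqrt s" for i
    have c1: "(\<Sum>i<n. (c i)\<^sup>2) = 1"
      using \<open>s > 0\<close> by (simp add: c_def power_divide s_def flip: sum_divide_distrib)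
    have cA: "(\<Sum>i<n. c i * L2_inner S (u i) a) = 0" if "a \<in> A" for a
      using c0(2)[OF that] by (simp add: c_def flip: sum_divide_distrib)
    define w where "w x = (\<Sum>i<n. c i * u i x)" for x
    have w: "w \<in> L2 S"
      unfolding w_def by (intro L2_sum L2_scale u) simp
    have wa: "L2_inner S w a = (\<Sum>i<n. c i * L2_inner S (u i) a)" if "a \<in> L2 S" for a
      unfolding w_def by (intro L2_inner_sum_left u that) simp
    have wu: "L2_inner S w (u j) = c j" if "j < n" for j
    proof -
      have "L2_inner S w (u j) = (\<Sum>i<n. if i = j then c i else 0)"
        unfolding wa[OF u[OF that]] using 2(4) that by (intro sum.cong) auto
      then show ?thesis
        using that by simp
    qed
    have ww: "L2_inner S w w = 1"
      unfolding wa[OF w] using wu c1 by (simp add: L2_inner_commute[of S _ w] power2_eq_square)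
    have Fu: "F (u i) \<in> L2 S'" if "i < n" for i
      by (intro F_L2 u that)
    have "L2_inner S' (F w) (F w) = L2_inner S' (\<lambda>t. \<Sum>i<n. c i * F (u i) t) (F w)"
      unfolding L2_inner_def
    proof (rule integral_cong_AE)
      have "F (\<lambda>x. \<Sum>i<n. c i * u i x) = F w"
        by (simp add: w_def[abs_def])
      then have "AE t in lebesgue_on S'. F w t = (\<Sum>i<n. c i * F (u i) t)"
        using F_linear[of n u c] u by simp
      then show "AE t in lebesgue_on S'. F w t * F w t = (\<Sum>i<n. c i * F (u i) t) * F w t"
        by eventually_elim simp
    qed (use F_L2[OF w] Fu in \<open>auto simp: L2_def intro!: borel_measurable_times borel_measurable_sum\<close>)
    also have "\<dots> = (\<Sum>i<n. c i * L2_inner S' (F (u i)) (F w))"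
      by (intro L2_inner_sum_left Fu F_L2 w) simp
    \<comment> \<open>The adjoint relation for \<open>u i\<close>, tested with w, gives the square
      of \<open>\<tau> i\<close> times the coefficient \<open>c i\<close>; no mixed terms
      survive.\<close>
    also have "\<dots> = (\<Sum>i<n. (c i)\<^sup>2 * (\<tau> i)\<^sup>2)"
    proof (intro sum.cong refl)
      fix i assume "i \<in> {..<n}"
      then have i: "i < n" by simp
      have "L2_inner S' (F w) (F (u i)) = L2_inner S w (\<lambda>x. (\<tau> i)\<^sup>2 * u i x)"
        using 2(3)[OF i] w by (simp add: singular_function_def adjoint_value_def)
      also have "\<dots> = (\<tau> i)\<^sup>2 * L2_inner S w (u i)"
        unfolding L2_inner_def by (subst integral_mult_right_zero[symmetric]) (simp add: mult_ac)
      finally show "c i * L2_inner S' (F (u i)) (F w) = (c i)\<^sup>2 * (\<tau> i)\<^sup>2"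
        using wu[OF i] by (simp add: L2_inner_commute[of S' _ "F w"] power2_eq_square)
    qed
    also have "\<dots> \<ge> (\<Sum>i<n. (c i)\<^sup>2 * \<mu>\<^sup>2)"
      using 2(1,2) by (intro sum_mono mult_left_mono power_mono) (auto simp: less_imp_le)
    finally have "\<mu>\<^sup>2 \<le> L2_inner S' (F w) (F w)"
      using c1 by (simp flip: sum_distrib_right)
    also have "\<dots> \<le> E\<^sup>2"
    proof (rule bound[OF w ww])
      fix a assume "a \<in> A"
      then show "L2_inner S w a = 0"
        using wa[of a] cA[of a] A by auto
    qed
    finally show ?thesis
      using \<open>E \<ge> 0\<close> by (rule power2_le_imp_le)
  qed (use \<open>E \<ge> 0\<close> in simp)
qed simp

section \<open>Kernels depending on a difference\<close>

text \<open>Rounding all coordinates down to multiples of 1/m moves a point by at most d/m, which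
  gives L. If the coordinates are bounded by M, each takes 2 M m + 1 \<le> (2 M + 1) m values, which
  gives K.\<close>

lemma bounded_grid_covering:
  fixes S :: "'a::euclidean_space set"
  assumes "bounded S"
  obtains K :: nat and L :: real where "L \<ge> 0"
    "\<And>m. m \<ge> 1 \<Longrightarrow> \<exists>Z. finite Z \<and> card Z \<le> K * m ^ DIM('a) \<and> (\<forall>x\<in>S. \<exists>z\<in>Z. norm (z - x) \<le> L / real m)"
proof -
  obtain M0 where M0: "\<And>x. x \<in> S \<Longrightarrow> norm x \<le> M0"
    using assms by (auto simp: bounded_iff)
  define M where "M = nat \<lceil>M0\<rceil>"
  have M: "\<bar>x \<bullet> b\<bar> \<le> real M" if "x \<in> S" "b \<in> Basis" for x b
    using Basis_le_norm[OF that(2), of x] M0[OF that(1)] unfolding M_def by linarith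
  show thesis
  proof (rule that[of "real DIM('a)" "(2 * M + 1) ^ DIM('a)"])
    fix m :: nat assume m: "m \<ge> 1"
    define T where "T = (\<lambda>k::int. real_of_int k / real m) ` {- int (M * m)..int (M * m)}"
    define E where "E = (\<Pi>\<^sub>E b\<in>(Basis :: 'a set). T)"
    define point where "point f = (\<Sum>b\<in>Basis. f b *\<^sub>R b)" for f :: "'a \<Rightarrow> real"
    have "card T \<le> card {- int (M * m)..int (M * m)}"
      unfolding T_def by (rule card_image_le) simp
    also have "\<dots> = 2 * M * m + 1"
      by (simp add: nat_eq_iff)
    also have "\<dots> \<le> (2 * M + 1) * m"
      using m by simp
    finally have "card T ^ DIM('a) \<le> (2 * M + 1) ^ DIM('a) * m ^ DIM('a)"
      by (metis power_mono power_mult_distrib zero_le)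
    moreover have "finite E"
      unfolding E_def T_def by (intro finite_PiE) auto
    then have "card (point ` E) \<le> card T ^ DIM('a)"
      using card_image_le[of E point] by (simp add: E_def card_PiE)
    moreover have "\<exists>z\<in>point ` E. norm (z - x) \<le> real DIM('a) / real m" if x: "x \<in> S" for x
    proof -
      define f where "f b = (if b \<in> Basis then real_of_int \<lfloor>real m * (x \<bullet> b)\<rfloor> / real m else undefined)" for b :: 'a
      have "f \<in> E"
        unfolding E_def
      proof (rule PiE_I)
        fix b :: 'a assume b: "b \<in> Basis"
        have "real m * \<bar>x \<bullet> b\<bar> \<le> real m * real M"
          using M[OF x b] by (intro mult_left_mono) auto
        then have "\<bar>real m * (x \<bullet> b)\<bar> \<le> real (M * m)"
          by (simp add: abs_mult mult.commute)
        then have "\<lfloor>real m * (x \<bullet> b)\<rfloor> \<in> {- int (M * m)..int (M * m)}"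
          unfolding atLeastAtMost_iff by linarith
        then show "f b \<in> T"
          using b by (auto simp: f_def T_def)
      qed (simp add: f_def)
      moreover have "norm (point f - x) \<le> real DIM('a) / real m"
      proof -
        have "norm (point f - x) \<le> (\<Sum>b\<in>Basis. \<bar>(point f - x) \<bullet> b\<bar>)"
          by (rule norm_le_l1)
        also have "\<dots> \<le> (\<Sum>b\<in>(Basis::'a set). 1 / real m)"
        proof (rule sum_mono)
          fix b :: 'a assume b: "b \<in> Basis"
          have "(point f - x) \<bullet> b = f b - x \<bullet> b"
            using b by (simp add: point_def inner_diff_left)
          also have "\<dots> = (real_of_int \<lfloor>real m * (x \<bullet> b)\<rfloor> - real m * (x \<bullet> b)) / real m"
            using b m by (simp add: f_def field_simps)
          also have "\<bar>\<dots>\<bar> \<le> 1 / real m"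
          proof -
            have "\<bar>real_of_int \<lfloor>real m * (x \<bullet> b)\<rfloor> - real m * (x \<bullet> b)\<bar> \<le> 1"
              by linarith
            then show ?thesis
              by (simp add: abs_divide divide_right_mono)
          qed
          finally show "\<bar>(point f - x) \<bullet> b\<bar> \<le> 1 / real m" .
        qed
        finally show ?thesis
          by simp
      qed
      ultimately show ?thesis by blast
    qed
    ultimately show "\<exists>Z. finite Z \<and> card Z \<le> (2 * M + 1) ^ DIM('a) * m ^ DIM('a) \<and>
        (\<forall>x\<in>S. \<exists>z\<in>Z. norm (z - x) \<le> real DIM('a) / real m)"
      using \<open>finite E\<close> by (intro exI[of _ "point ` E"]) auto
  qed simp
qed

text \<open>For n > A take m just below x = (n/A)^(1/d). It is at least x/2, so m^(-N) is at most
  2^N (n/A)^(-N/d), and N/d \<ge> e. For n \<le> A the uniform bound C suffices, as (n/A)^(-e) \<ge>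
  1.\<close>

lemma decay_from_power_count:
  fixes \<sigma> :: "nat \<Rightarrow> real" and d A N :: nat
  assumes "d \<ge> 1" "A \<ge> 1" "C \<ge> 0" "e \<ge> 0" "e * real d \<le> real N"
    and small: "\<And>n. n \<ge> 1 \<Longrightarrow> \<sigma> n \<le> C"
    and large: "\<And>n m. m \<ge> 1 \<Longrightarrow> A * m ^ d < n \<Longrightarrow> \<sigma> n \<le> C * (1 / real m) ^ N"
  shows "\<exists>C'. \<forall>n\<ge>1. \<sigma> n \<le> C' * real n powr (- e)"
proof (intro exI allI impI)
  fix n :: nat assume n: "n \<ge> 1"
  let ?x = "(real n / real A) powr (1 / real d)"
  have A: "real A > 0" using assms by simp
  have nA: "real n powr - e = (real n / real A) powr - e * real A powr - e"
    using A n by (simp flip: powr_mult)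
  have "\<sigma> n \<le> C * 2 ^ N * (real n / real A) powr - e"
  proof (cases "n \<le> A")
    case True
    have "1 powr e \<le> (real A / real n) powr e"
      using True n assms by (intro powr_mono2) auto
    also have "(real A / real n) powr e = (real n / real A) powr - e"
      using A n by (simp add: powr_minus powr_divide)
    finally have "1 * 1 \<le> 2 ^ N * (real n / real A) powr - e"
      by (intro mult_mono) auto
    then have "C * 1 \<le> C * (2 ^ N * (real n / real A) powr - e)"
      using assms by (intro mult_left_mono) auto
    then show ?thesis
      using small[OF n] by (simp add: mult.assoc)
  next
    case False
    then have gt1: "real n / real A > 1"
      using A by simp
    then have x: "?x > 1"
      using assms by (simp add: gr_one_powr)
    \<comment> \<open>Ceiling minus one instead of the floor stays strictly below \<open>?x\<close>
      even if that is an integer, as the strict inequality in \<open>large\<close> requires.\<close>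
    define m where "m = nat (\<lceil>?x\<rceil> - 1)"
    have m: "m \<ge> 1" "real m < ?x" "real m \<ge> ?x / 2"
    proof -
      have "\<lceil>?x\<rceil> \<ge> 2"
        using x by linarith
      then have rm: "real m = real_of_int \<lceil>?x\<rceil> - 1" and "m \<ge> 1"
        unfolding m_def by linarith+
      then show "m \<ge> 1" by simp
      show "real m < ?x"
        unfolding rm by linarith
      have "real m \<ge> ?x - 1"
        unfolding rm by linarith
      moreover have "real m \<ge> 1"
        using \<open>m \<ge> 1\<close> by simp
      ultimately show "real m \<ge> ?x / 2"
        by linarith
    qed
    have xd: "?x ^ d = real n / real A"
      using gt1 assms by (simp add: powr_powr flip: powr_realpow)
    have "real m ^ d < ?x ^ d"
      using m assms by (intro power_strict_mono) auto
    then have "real m ^ d < real n / real A"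
      by (simp only: xd)
    then have "real A * real m ^ d < real n"
      using A by (simp add: field_simps)
    then have "A * m ^ d < n"
      by (simp flip: of_nat_power of_nat_mult)
    then have "\<sigma> n \<le> C * (1 / real m) ^ N"
      using m by (intro large) auto
    also have "\<dots> \<le> C * (2 / ?x) ^ N"
    proof -
      have "1 / real m \<le> 2 / ?x"
        using frac_le[of 1 1 "?x / 2" "real m"] m x n A by simp
      then show ?thesis
        using assms by (intro mult_left_mono power_mono) auto
    qed
    also have "(2 / ?x) ^ N = 2 ^ N * (real n / real A) powr (- (real N / real d))"
    proof -
      have "?x ^ N = (real n / real A) powr (real N / real d)"
        using powr_realpow[of ?x N] x n A by (simp add: powr_powr)
      then show ?thesis
        by (simp only: power_divide powr_minus divide_inverse[of "2 ^ N"])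
    qed
    also have "\<dots> \<le> 2 ^ N * (real n / real A) powr - e"
      using gt1 assms by (intro mult_left_mono powr_mono) (auto simp: field_simps)
    finally show ?thesis
      using assms(3) by (simp add: mult_left_mono mult.assoc)
  qed
  then show "\<sigma> n \<le> (C * 2 ^ N / real A powr - e) * real n powr (- e)"
    unfolding nA using A by simp
qed

text \<open>Elements of \<open>L2\<close> are functions, so a change on a null set needs an
  argument: g is measurable where it equals f, and Lebesgue measure is complete.\<close>

lemma L2_cong_AE:
  assumes f: "f \<in> L2 S" and S: "S \<in> sets lebesgue" and N: "negligible N"
    and eq: "\<And>x. x \<in> S - N \<Longrightarrow> f x = g x"
  shows "g \<in> L2 S"
proof -
  have "negligible (N \<inter> S)"
    using N by (rule negligible_subset) auto
  then have NS: "N \<inter> S \<in> null_sets (lebesgue_on S)"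
    using S by (subst null_sets_restrict_space) (auto simp: negligible_iff_null_sets)
  have "AE x in lebesgue_on S. x \<notin> N \<inter> S"
    using NS by (rule AE_not_in)
  then have ae: "AE x in lebesgue_on S. f x = g x"
    by (rule lebesgue_on_mono) (use eq in auto)
  have "f \<in> borel_measurable (lebesgue_on (S - N \<inter> S))"
    using f NS S by (subst borel_measurable_diff_null) (auto simp: L2_def)
  then have "g \<in> borel_measurable (lebesgue_on (S - N \<inter> S))"
    by (rule measurable_lebesgue_cong[THEN iffD1, rotated]) (use eq in auto)
  then have g: "g \<in> borel_measurable (lebesgue_on S)"
    using NS S by (subst (asm) borel_measurable_diff_null) auto
  moreover have "integrable (lebesgue_on S) (\<lambda>x. (g x)\<^sup>2)"
    using f ae g by (subst integrable_cong_AE[of _ _ "\<lambda>x. (f x)\<^sup>2"]) (auto simp: L2_def)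
  ultimately show ?thesis
    by (simp add: L2_def)
qed

lemma L2_mult_bounded:
  assumes "f \<in> L2 S" "g \<in> borel_measurable (lebesgue_on S)" "\<And>x. x \<in> S \<Longrightarrow> \<bar>g x\<bar> \<le> B"
  shows "(\<lambda>x. f x * g x) \<in> L2 S"
proof -
  have "integrable (lebesgue_on S) (\<lambda>x. (f x * g x)\<^sup>2)"
  proof (rule Bochner_Integration.integrable_bound)
    show "integrable (lebesgue_on S) (\<lambda>x. B\<^sup>2 * (f x)\<^sup>2)"
      using assms by (simp add: L2_def)
    show "AE x in lebesgue_on S. norm ((f x * g x)\<^sup>2) \<le> norm (B\<^sup>2 * (f x)\<^sup>2)"
    proof (rule AE_I2)
      fix x assume "x \<in> space (lebesgue_on S)"
      then have "(g x)\<^sup>2 \<le> B\<^sup>2"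
        using assms(3)[of x] by (simp add: abs_le_square_iff[symmetric])
      then show "norm ((f x * g x)\<^sup>2) \<le> norm (B\<^sup>2 * (f x)\<^sup>2)"
        using mult_left_mono[of "(g x)\<^sup>2" "B\<^sup>2" "(f x)\<^sup>2"] by (simp add: power_mult_distrib mult.commute)
    qed
  qed (use assms in \<open>auto simp: L2_def\<close>)
  then show ?thesis
    using assms by (auto simp: L2_def)
qed

lemma bounded_measurable_in_L2:
  assumes "S \<in> lmeasurable" "g \<in> borel_measurable (lebesgue_on S)" "\<And>x. x \<in> S \<Longrightarrow> \<bar>g x\<bar> \<le> B"
  shows "g \<in> L2 S"
proof -
  interpret finite_measure "lebesgue_on S"
    using assms(1) by (rule finite_measure_lebesgue_on)
  have "(\<lambda>_. 1) \<in> L2 S"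
    by (simp add: L2_def)
  from L2_mult_bounded[OF this assms(2,3)] show ?thesis
    by simp
qed

text \<open>In each summand of the kernel x and t meet only in the argument \<open>g x - h t\<close>
  of a function all of whose derivatives are bounded. The grid lives in the common target space of g
  and h, so its dimension governs the count; e is arbitrary because the Taylor order is.\<close>

lemma difference_kernel_singular_values:
  fixes \<Omega> :: "'a::euclidean_space set" and S' :: "'b::euclidean_space set"
    and g :: "'a \<Rightarrow> 'c::euclidean_space" and h :: "'b \<Rightarrow> 'c"
    and P :: "'j \<Rightarrow> 'a \<Rightarrow> real" and G :: "'j \<Rightarrow> 'c \<Rightarrow> real" and V :: "'j \<Rightarrow> 'b \<Rightarrow> real"
    and F :: "('a \<Rightarrow> real) \<Rightarrow> 'b \<Rightarrow> real"
  assumes \<Omega>: "\<Omega> \<in> lmeasurable" and S': "S' \<in> sets lebesgue"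
    and J: "finite J"
    and P: "\<And>j. j \<in> J \<Longrightarrow> P j \<in> borel_measurable (lebesgue_on \<Omega>)"
      "\<And>j. j \<in> J \<Longrightarrow> bounded (P j ` \<Omega>)"
    and \<F>: "differentiation_closed \<F>" "\<And>f. f \<in> \<F> \<Longrightarrow> bounded (range f)" "\<And>j. j \<in> J \<Longrightarrow> G j \<in> \<F>"
    and V: "\<And>j. j \<in> J \<Longrightarrow> V j \<in> L2 S'"
    and g: "g \<in> borel_measurable (lebesgue_on \<Omega>)"
    and h: "h \<in> borel_measurable (lebesgue_on S')" "bounded (h ` S')"
    and N0: "negligible N0"
    and F: "\<And>c t. t \<in> S' - N0 \<Longrightarrow> F c t = (\<integral>x. c x * (\<Sum>j\<in>J. P j x * G j (g x - h t) * V j t) \<partial>lebesgue_on \<Omega>)"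
    and e: "e > 0"
  shows "(\<forall>c\<in>L2 \<Omega>. F c \<in> L2 S') \<and> (\<exists>C. \<forall>n\<ge>1. singular_value \<Omega> S' F n \<le> C * real n powr (- e))"
proof -
  interpret finite_measure "lebesgue_on \<Omega>"
    using \<Omega> by (rule finite_measure_lebesgue_on)
  have \<Omega>_sets: "\<Omega> \<in> sets lebesgue"
    using \<Omega> by blast
  have "\<exists>B. \<forall>j\<in>J. B j \<ge> 0 \<and> (\<forall>x\<in>\<Omega>. \<bar>P j x\<bar> \<le> B j)"
  proof (rule bchoice, rule ballI)
    fix j assume "j \<in> J"
    then obtain B where "B > 0" "\<forall>x\<in>\<Omega>. \<bar>P j x\<bar> \<le> B"
      using P(2)[of j] by (auto simp: bounded_pos)
    then show "\<exists>B\<ge>0. \<forall>x\<in>\<Omega>. \<bar>P j x\<bar> \<le> B"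
      by (intro exI[of _ B]) simp
  qed
  then obtain PB where PB0: "\<And>j. j \<in> J \<Longrightarrow> PB j \<ge> 0"
    and PB: "\<And>j x. j \<in> J \<Longrightarrow> x \<in> \<Omega> \<Longrightarrow> \<bar>P j x\<bar> \<le> PB j"
    by blast
  have "\<exists>B. \<forall>f\<in>\<F>. \<forall>y. \<bar>f y\<bar> \<le> B f"
  proof (rule bchoice, rule ballI)
    fix f assume "f \<in> \<F>"
    then show "\<exists>B. \<forall>y. \<bar>f y\<bar> \<le> B"
      using \<F>(2)[of f] by (auto simp: bounded_iff)
  qed
  then obtain FB where FB: "\<And>f y. f \<in> \<F> \<Longrightarrow> \<bar>f y\<bar> \<le> FB f"
    by blast
  have cont: "continuous_on UNIV f" if "f \<in> \<F>" for f
  proof (rule continuous_at_imp_continuous_on, rule ballI)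
    fix y
    have "f differentiable (at y)"
      using partials_differentiable[OF \<F>(1) that, of "[]"] by simp
    then show "isCont f y"
      by (rule differentiable_imp_continuous_within)
  qed
  have comp_meas: "(\<lambda>x. f (g x - \<eta>)) \<in> borel_measurable (lebesgue_on \<Omega>)" if "f \<in> \<F>" for f \<eta>
    using borel_measurable_continuous_onI[OF cont[OF that]] g by measurable
  have factor_meas: "(\<lambda>x. P j x * f (g x - \<eta>)) \<in> borel_measurable (lebesgue_on \<Omega>)"
    if "f \<in> \<F>" "j \<in> J" for f j \<eta>
    using P(1)[OF that(2)] comp_meas[OF that(1)] by (rule borel_measurable_times)
  have factor_bound: "\<bar>P j x * f (g x - \<eta>)\<bar> \<le> PB j * FB f" if "f \<in> \<F>" "j \<in> J" "x \<in> \<Omega>" for f j \<eta> x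
    unfolding abs_mult using PB[OF that(2,3)] FB[OF that(1)] by (intro mult_mono) auto
  have int: "integrable (lebesgue_on \<Omega>) (\<lambda>x. c x * (P j x * f (g x - \<eta>)))"
    if "c \<in> L2 \<Omega>" "f \<in> \<F>" "j \<in> J" for c f j \<eta>
    by (rule L2_imp_integrable[OF \<Omega> L2_mult_bounded[OF that(1) factor_meas[OF that(2,3)] factor_bound[OF that(2,3)]]])

  \<comment> \<open>The value \<open>h t\<close> is replaced by a free parameter \<eta>; continuity
    in \<eta> makes \<open>F c\<close> measurable through composition with h.\<close>
  define \<Psi> where "\<Psi> j c \<eta> = (\<integral>x. c x * (P j x * G j (g x - \<eta>)) \<partial>lebesgue_on \<Omega>)" for j c \<eta>
  have F_eq: "F c t = (\<Sum>j\<in>J. V j t * \<Psi> j c (h t))" if "c \<in> L2 \<Omega>" "t \<in> S' - N0" for c t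
  proof -
    have "F c t = (\<integral>x. (\<Sum>j\<in>J. V j t * (c x * (P j x * G j (g x - h t)))) \<partial>lebesgue_on \<Omega>)"
      unfolding F[OF that(2)] by (simp add: sum_distrib_left mult_ac)
    also have "\<dots> = (\<Sum>j\<in>J. V j t * \<Psi> j c (h t))"
      unfolding \<Psi>_def using int[OF that(1) \<F>(3)] by simp
    finally show ?thesis .
  qed
  have \<Psi>_bound: "\<bar>\<Psi> j c \<eta>\<bar> \<le> PB j * FB (G j) * (\<integral>x. \<bar>c x\<bar> \<partial>lebesgue_on \<Omega>)"
    if c: "c \<in> L2 \<Omega>" and j: "j \<in> J" for j c \<eta>
  proof -
    have "\<bar>\<Psi> j c \<eta>\<bar> \<le> (\<integral>x. PB j * FB (G j) * \<bar>c x\<bar> \<partial>lebesgue_on \<Omega>)"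
      unfolding \<Psi>_def
    proof (rule integral_abs_bound_integral[OF int[OF c \<F>(3)[OF j] j]])
      show "integrable (lebesgue_on \<Omega>) (\<lambda>x. PB j * FB (G j) * \<bar>c x\<bar>)"
        using L2_imp_integrable[OF \<Omega> c] by simp
      fix x assume "x \<in> space (lebesgue_on \<Omega>)"
      then have "\<bar>P j x * G j (g x - \<eta>)\<bar> \<le> PB j * FB (G j)"
        using factor_bound[OF \<F>(3)[OF j] j] by simp
      then show "\<bar>c x * (P j x * G j (g x - \<eta>))\<bar> \<le> PB j * FB (G j) * \<bar>c x\<bar>"
        unfolding abs_mult[of "c x"] by (subst mult.commute) (rule mult_right_mono, auto)
    qed
    then show ?thesis by simp
  qed
  have \<Psi>_cont: "continuous_on UNIV (\<Psi> j c)" if c: "c \<in> L2 \<Omega>" and j: "j \<in> J" for j c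
    unfolding continuous_on_sequentially
  proof (intro allI impI ballI)
    fix X :: "nat \<Rightarrow> 'c" and \<eta>
    assume X: "(\<forall>n. X n \<in> UNIV) \<and> X \<longlonglongrightarrow> \<eta>"
    have "(\<lambda>n. \<Psi> j c (X n)) \<longlonglongrightarrow> \<Psi> j c \<eta>"
      unfolding \<Psi>_def
    proof (rule integral_dominated_convergence[where w = "\<lambda>x. PB j * FB (G j) * \<bar>c x\<bar>"])
      show "integrable (lebesgue_on \<Omega>) (\<lambda>x. PB j * FB (G j) * \<bar>c x\<bar>)"
        using L2_imp_integrable[OF \<Omega> c] by simp
      show "(\<lambda>x. c x * (P j x * G j (g x - \<eta>))) \<in> borel_measurable (lebesgue_on \<Omega>)" for \<eta>
        using int[OF c \<F>(3)[OF j] j] by (rule borel_measurable_integrable)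
      then show "(\<lambda>x. c x * (P j x * G j (g x - X n))) \<in> borel_measurable (lebesgue_on \<Omega>)" for n .
      show "AE x in lebesgue_on \<Omega>. (\<lambda>n. c x * (P j x * G j (g x - X n))) \<longlonglongrightarrow> c x * (P j x * G j (g x - \<eta>))"
      proof (rule AE_I2)
        fix x
        have "isCont (G j) (g x - \<eta>)"
          using cont[OF \<F>(3)[OF j]] by (simp add: continuous_on_eq_continuous_at)
        then have "(\<lambda>n. G j (g x - X n)) \<longlonglongrightarrow> G j (g x - \<eta>)"
          using X by (intro isCont_tendsto_compose[of _ "G j"] tendsto_diff tendsto_const) auto
        then show "(\<lambda>n. c x * (P j x * G j (g x - X n))) \<longlonglongrightarrow> c x * (P j x * G j (g x - \<eta>))"
          by (intro tendsto_mult tendsto_const)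
      qed
      show "AE x in lebesgue_on \<Omega>. norm (c x * (P j x * G j (g x - X n))) \<le> PB j * FB (G j) * \<bar>c x\<bar>" for n
      proof (rule AE_I2)
        fix x assume "x \<in> space (lebesgue_on \<Omega>)"
        then have "\<bar>P j x * G j (g x - X n)\<bar> \<le> PB j * FB (G j)"
          using factor_bound[OF \<F>(3)[OF j] j] by simp
        then show "norm (c x * (P j x * G j (g x - X n))) \<le> PB j * FB (G j) * \<bar>c x\<bar>"
          unfolding real_norm_def abs_mult[of "c x"] by (subst mult.commute) (rule mult_right_mono, auto)
      qed
    qed
    then show "(\<Psi> j c \<circ> X) \<longlonglongrightarrow> \<Psi> j c \<eta>"
      by (simp add: o_def)
  qed
  have F_L2: "F c \<in> L2 S'" if c: "c \<in> L2 \<Omega>" for c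
  proof (rule L2_cong_AE[OF _ S' N0])
    show "(\<lambda>t. \<Sum>j\<in>J. V j t * \<Psi> j c (h t)) \<in> L2 S'"
    proof (intro L2_sum L2_mult_bounded[OF V])
      fix j assume j: "j \<in> J"
      show "(\<lambda>t. \<Psi> j c (h t)) \<in> borel_measurable (lebesgue_on S')"
        using borel_measurable_continuous_onI[OF \<Psi>_cont[OF c j]] h(1) by measurable
      show "\<bar>\<Psi> j c (h t)\<bar> \<le> PB j * FB (G j) * (\<integral>x. \<bar>c x\<bar> \<partial>lebesgue_on \<Omega>)" for t
        by (rule \<Psi>_bound[OF c j])
    qed
    show "(\<Sum>j\<in>J. V j t * \<Psi> j c (h t)) = F c t" if "t \<in> S' - N0" for t
      using F_eq[OF c that] by simp
  qed
  have ae: "AE t in lebesgue_on S'. t \<in> S' - N0"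
  proof -
    have "AE t in lebesgue. t \<notin> N0"
      using N0 by (intro AE_not_in) (simp add: negligible_iff_null_sets)
    then show ?thesis
      using S' by (subst AE_restrict_space_iff) auto
  qed
  have F_linear: "AE t in lebesgue_on S'. F (\<lambda>x. \<Sum>i<n. c i * u i x) t = (\<Sum>i<n. c i * F (u i) t)"
    if u: "\<And>i. i < n \<Longrightarrow> u i \<in> L2 \<Omega>" for u :: "nat \<Rightarrow> 'a \<Rightarrow> real" and c n
    using ae
  proof eventually_elim
    case (elim t)
    have sum_L2: "(\<lambda>x. \<Sum>i<n. c i * u i x) \<in> L2 \<Omega>"
      by (intro L2_sum L2_scale u) simp
    have lin: "\<Psi> j (\<lambda>x. \<Sum>i<n. c i * u i x) (h t) = (\<Sum>i<n. c i * \<Psi> j (u i) (h t))" if j: "j \<in> J" for j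
    proof -
      have "(\<lambda>x. (\<Sum>i<n. c i * u i x) * (P j x * G j (g x - h t)))
          = (\<lambda>x. \<Sum>i<n. c i * (u i x * (P j x * G j (g x - h t))))"
        by (simp add: sum_distrib_right mult.assoc)
      then show ?thesis
        unfolding \<Psi>_def using int[OF u \<F>(3)[OF j] j] by simp
    qed
    have "F (\<lambda>x. \<Sum>i<n. c i * u i x) t = (\<Sum>j\<in>J. V j t * (\<Sum>i<n. c i * \<Psi> j (u i) (h t)))"
      unfolding F_eq[OF sum_L2 elim] by (intro sum.cong refl) (simp add: lin)
    also have "\<dots> = (\<Sum>i<n. \<Sum>j\<in>J. c i * (V j t * \<Psi> j (u i) (h t)))"
      unfolding sum_distrib_left by (subst sum.swap) (simp add: mult_ac)
    also have "\<dots> = (\<Sum>i<n. c i * F (u i) t)"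
      unfolding sum_distrib_left[symmetric] by (intro sum.cong refl) (simp add: F_eq[OF u elim])
    finally show ?case .
  qed

  \<comment> \<open>\<open>Suc\<close> guarantees the positive order that
    \<open>taylor_bound\<close> asks for, the ceiling the rate e.\<close>
  define N where "N = Suc (nat \<lceil>e * real DIM('c)\<rceil>)"
  have N: "N > 0" "e * real DIM('c) \<le> real N"
    unfolding N_def by linarith+
  have "\<exists>C\<ge>0. \<forall>w v. \<bar>G j (w + v) - (\<Sum>k<N. taylor_term k (G j) w v / fact k)\<bar> \<le> C * norm v ^ N" if "j \<in> J" for j
    using taylor_bound[OF \<F>(1) \<F>(3)[OF that] \<F>(2) N(1)] by metis
  then obtain TB where TB: "\<And>j. j \<in> J \<Longrightarrow> TB j \<ge> 0"
    "\<And>j w v. j \<in> J \<Longrightarrow> \<bar>G j (w + v) - (\<Sum>k<N. taylor_term k (G j) w v / fact k)\<bar> \<le> TB j * norm v ^ N"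
    by metis
  obtain K L where L: "L \<ge> 0" and cover: "\<And>m. m \<ge> 1 \<Longrightarrow>
      \<exists>Z. finite Z \<and> card Z \<le> K * m ^ DIM('c) \<and> (\<forall>\<eta>\<in>h ` S'. \<exists>z\<in>Z. norm (z - \<eta>) \<le> L / real m)"
    using bounded_grid_covering[OF h(2)] by metis
  define W where "W t = (\<Sum>j\<in>J. \<bar>V j t\<bar>)" for t
  have W: "W \<in> L2 S'"
    unfolding W_def using V by (intro L2_sum) (auto simp: L2_def intro!: borel_measurable_abs)
  define W2 where "W2 = L2_inner S' W W"
  have W2: "W2 \<ge> 0"
    unfolding W2_def L2_inner_def by simp
  \<comment> \<open>A bound for the L^1 norm of a unit vector u, from |u| \<le> 1 + u^2.\<close>
  define M where "M = measure lebesgue \<Omega> + 1"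
  have M: "M \<ge> 0"
    by (simp add: M_def)
  have u_int: "(\<integral>x. \<bar>u x\<bar> \<partial>lebesgue_on \<Omega>) \<le> M" if u: "u \<in> L2 \<Omega>" "L2_inner \<Omega> u u = 1" for u
  proof -
    have i: "integrable (lebesgue_on \<Omega>) (\<lambda>x. u x * u x)"
      by (rule L2_product_integrable[OF u(1) u(1)])
    have "(\<integral>x. \<bar>u x\<bar> \<partial>lebesgue_on \<Omega>) \<le> (\<integral>x. 1 + u x * u x \<partial>lebesgue_on \<Omega>)"
    proof (rule integral_mono)
      show "\<bar>u x\<bar> \<le> 1 + u x * u x" for x
        using sum_squares_bound[of 1 "\<bar>u x\<bar>"] by (simp add: power2_eq_square)
    qed (use L2_imp_integrable[OF \<Omega> u(1)] i in auto)
    also have "\<dots> = M"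
      using i u(2) \<Omega>_sets by (simp add: L2_inner_def M_def measure_restrict_space)
    finally show ?thesis .
  qed
  \<comment> \<open>A uniform bound B for \<open>\<Psi>\<close> on the range of h suffices: |F u t|
    is then at most B times \<open>W t\<close>, and W is square integrable.\<close>
  have FF: "L2_inner S' (F u) (F u) \<le> (B * sqrt W2)\<^sup>2"
    if u: "u \<in> L2 \<Omega>" and B: "\<And>j t. j \<in> J \<Longrightarrow> t \<in> S' \<Longrightarrow> \<bar>\<Psi> j u (h t)\<bar> \<le> B" for u B
  proof -
    have "L2_inner S' (F u) (F u) \<le> (\<integral>t. B\<^sup>2 * (W t * W t) \<partial>lebesgue_on S')"
      unfolding L2_inner_def
    proof (rule integral_mono_AE)
      show "AE t in lebesgue_on S'. F u t * F u t \<le> B\<^sup>2 * (W t * W t)"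
        using ae
      proof eventually_elim
        case (elim t)
        have "\<bar>F u t\<bar> \<le> (\<Sum>j\<in>J. \<bar>V j t\<bar> * B)"
          unfolding F_eq[OF u elim] using elim B
          by (intro order_trans[OF sum_abs] sum_mono) (auto simp: abs_mult intro!: mult_left_mono)
        then have "\<bar>F u t\<bar> \<le> B * W t"
          by (simp add: W_def mult.commute flip: sum_distrib_left)
        then have "(F u t)\<^sup>2 \<le> (B * W t)\<^sup>2"
          by (metis abs_ge_zero power2_abs power_mono)
        then show ?case
          by (simp add: power2_eq_square mult_ac)
      qed
    qed (use L2_product_integrable[OF F_L2[OF u] F_L2[OF u]] L2_product_integrable[OF W W] in auto)
    also have "\<dots> = (B * sqrt W2)\<^sup>2"
      using W2 by (simp add: power_mult_distrib W2_def L2_inner_def)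
    finally show ?thesis .
  qed
  define C0 where "C0 = (\<Sum>j\<in>J. PB j * FB (G j))"
  define C1 where "C1 = (\<Sum>j\<in>J. PB j * TB j * L ^ N)"
  have FB0: "FB (G j) \<ge> 0" if "j \<in> J" for j
    using FB[OF \<F>(3)[OF that], of undefined] by linarith
  have C0: "PB j * FB (G j) \<le> C0" "C0 \<ge> 0" if "j \<in> J" for j
    unfolding C0_def using that J PB0 FB0
    by (auto intro!: member_le_sum[of j J "\<lambda>j. PB j * FB (G j)"] sum_nonneg mult_nonneg_nonneg)
  have C1: "PB j * TB j * L ^ N \<le> C1" if "j \<in> J" for j
    unfolding C1_def using that J PB0 TB(1) L
    by (intro member_le_sum[of j J "\<lambda>j. PB j * TB j * L ^ N"]) (auto intro!: mult_nonneg_nonneg)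
  have C_nonneg: "C0 \<ge> 0" "C1 \<ge> 0"
    unfolding C0_def C1_def using PB0 TB(1) FB0 L
    by (auto intro!: sum_nonneg mult_nonneg_nonneg)
  define C where "C = M * (C0 + C1) * sqrt W2"
  have small: "singular_value \<Omega> S' F n \<le> C" if "n \<ge> 1" for n
  proof -
    \<comment> \<open>The empty set of constraints yields a bound valid for every n \<ge> 1, which
      covers those n that are too small for any grid.\<close>
    have "singular_value \<Omega> S' F n \<le> M * C0 * sqrt W2"
    proof (rule singular_value_le[OF S' F_L2 F_linear, where A = "{}"])
      fix u assume u: "u \<in> L2 \<Omega>" "L2_inner \<Omega> u u = 1"
      show "L2_inner S' (F u) (F u) \<le> (M * C0 * sqrt W2)\<^sup>2"
      proof (rule FF[OF u(1)])
        fix j t assume j: "j \<in> J"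
        have "\<bar>\<Psi> j u (h t)\<bar> \<le> PB j * FB (G j) * (\<integral>x. \<bar>u x\<bar> \<partial>lebesgue_on \<Omega>)"
          by (rule \<Psi>_bound[OF u(1) j])
        also have "\<dots> \<le> C0 * M"
          using C0[OF j] u_int[OF u] by (intro mult_mono) auto
        finally show "\<bar>\<Psi> j u (h t)\<bar> \<le> M * C0"
          by (simp add: mult.commute)
      qed
    qed (use that M C_nonneg W2 in auto)
    also have "\<dots> \<le> C"
      unfolding C_def using M C_nonneg W2 by (intro mult_right_mono mult_left_mono) auto
    finally show ?thesis .
  qed
  define D where "D = (\<Union>k<N. directions k :: 'c list set)"
  have D: "finite D"
    unfolding D_def by (auto intro: finite_directions)
  \<comment> \<open>The product bounds the number of constraints per m^d; adding 1 secures the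
    positive constant that \<open>decay_from_power_count\<close> demands.\<close>
  define A0 where "A0 = card J * K * card D + 1"
  have large: "singular_value \<Omega> S' F n \<le> C * (1 / real m) ^ N" if m: "m \<ge> 1" and n: "A0 * m ^ DIM('c) < n" for n m
  proof -
    obtain Z where Z: "finite Z" "card Z \<le> K * m ^ DIM('c)" "\<And>t. t \<in> S' \<Longrightarrow> \<exists>z\<in>Z. norm (z - h t) \<le> L / real m"
      using cover[OF m] by blast
    \<comment> \<open>These functions do not contain t, so finitely many orthogonality conditions
      annihilate the Taylor polynomials of all t simultaneously.\<close>
    define a where "a = (\<lambda>(j, z, bs). \<lambda>x. P j x * partials bs (G j) (g x - z))"
    let ?A = "a ` (J \<times> Z \<times> D)"
    have partials_mem': "partials bs (G j) \<in> \<F>" if "j \<in> J" for j bs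
      by (rule partials_mem[OF \<F>(1) \<F>(3)[OF that]])
    have "singular_value \<Omega> S' F n \<le> M * (C1 * (1 / real m) ^ N) * sqrt W2"
    proof (rule singular_value_le[OF S' F_L2 F_linear, where A = ?A])
      show "finite ?A"
        using J Z D by auto
      have "card ?A \<le> card J * (card Z * card D)"
        using card_image_le[of "J \<times> Z \<times> D" a] J Z D by (simp add: card_cartesian_product)
      also have "\<dots> \<le> card J * (K * m ^ DIM('c) * card D)"
        using Z by (intro mult_le_mono) auto
      also have "\<dots> \<le> A0 * m ^ DIM('c)"
        by (simp add: A0_def algebra_simps)
      finally show "card ?A < n"
        using n by simp
      show "?A \<subseteq> L2 \<Omega>"
      proof clarify
        fix j z bs assume j: "j \<in> J"
        show "a (j, z, bs) \<in> L2 \<Omega>"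
          unfolding a_def prod.case
          by (rule bounded_measurable_in_L2[OF \<Omega> factor_meas[OF partials_mem'[OF j] j]
                factor_bound[OF partials_mem'[OF j] j]])
      qed
      fix u assume u: "u \<in> L2 \<Omega>" "L2_inner \<Omega> u u = 1" and orth: "\<And>b. b \<in> ?A \<Longrightarrow> L2_inner \<Omega> u b = 0"
      show "L2_inner S' (F u) (F u) \<le> (M * (C1 * (1 / real m) ^ N) * sqrt W2)\<^sup>2"
      proof (rule FF[OF u(1)])
        fix j t assume j: "j \<in> J" and t: "t \<in> S'"
        obtain z where z: "z \<in> Z" "norm (z - h t) \<le> L / real m"
          using Z(3)[OF t] by blast
        \<comment> \<open>Base point \<open>g x - z\<close> and increment \<open>z - h t\<close> add
          up to \<open>g x - h t\<close>; thus t occurs only in scalar coefficients.\<close>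
        let ?T = "\<lambda>x. \<Sum>k<N. taylor_term k (G j) (g x - z) (z - h t) / fact k"
        have term_int: "integrable (lebesgue_on \<Omega>) (\<lambda>x. u x * (P j x * partials bs (G j) (g x - z)))" for bs
          by (rule int[OF u(1) partials_mem'[OF j] j])
        have T_eq: "u x * (P j x * ?T x) = (\<Sum>k<N. \<Sum>bs\<in>directions k.
            (\<Prod>b\<leftarrow>bs. (z - h t) \<bullet> b) / fact k * (u x * (P j x * partials bs (G j) (g x - z))))" for x
          by (simp add: taylor_term_def sum_distrib_left sum_divide_distrib mult_ac)
        have T_int: "integrable (lebesgue_on \<Omega>) (\<lambda>x. u x * (P j x * ?T x))"
          unfolding T_eq using term_int by simp
        have "(\<integral>x. u x * (P j x * ?T x) \<partial>lebesgue_on \<Omega>) = 0"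
        proof -
          have "(\<integral>x. u x * (P j x * partials bs (G j) (g x - z)) \<partial>lebesgue_on \<Omega>) = 0"
            if "k < N" "bs \<in> directions k" for k bs
          proof -
            have "(j, z, bs) \<in> J \<times> Z \<times> D"
              using j z that by (auto simp: D_def)
            then have "L2_inner \<Omega> u (a (j, z, bs)) = 0"
              by (intro orth imageI)
            then show ?thesis
              by (simp add: L2_inner_def a_def)
          qed
          then show ?thesis
            unfolding T_eq using term_int by simp
        qed
        then have "\<Psi> j u (h t) = (\<integral>x. u x * (P j x * G j (g x - h t)) - u x * (P j x * ?T x) \<partial>lebesgue_on \<Omega>)"
          unfolding \<Psi>_def using int[OF u(1) \<F>(3)[OF j] j] T_int
          by (subst Bochner_Integration.integral_diff) auto
        also have "\<bar>\<dots>\<bar> \<le> (\<integral>x. PB j * (TB j * (L / real m) ^ N) * \<bar>u x\<bar> \<partial>lebesgue_on \<Omega>)"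
        proof (rule integral_abs_bound_integral)
          show "integrable (lebesgue_on \<Omega>) (\<lambda>x. PB j * (TB j * (L / real m) ^ N) * \<bar>u x\<bar>)"
            using L2_imp_integrable[OF \<Omega> u(1)] by simp
          fix x assume x: "x \<in> space (lebesgue_on \<Omega>)"
          have "\<bar>G j (g x - h t) - ?T x\<bar> \<le> TB j * norm (z - h t) ^ N"
            using TB(2)[OF j, of "g x - z" "z - h t"] by simp
          also have "\<dots> \<le> TB j * (L / real m) ^ N"
            using z TB(1)[OF j] by (intro mult_left_mono power_mono) auto
          finally have "\<bar>P j x\<bar> * \<bar>G j (g x - h t) - ?T x\<bar> \<le> PB j * (TB j * (L / real m) ^ N)"
            using PB[OF j, of x] x by (intro mult_mono) auto
          then have "\<bar>u x\<bar> * (\<bar>P j x\<bar> * \<bar>G j (g x - h t) - ?T x\<bar>) \<le> \<bar>u x\<bar> * (PB j * (TB j * (L / real m) ^ N))"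
            by (intro mult_left_mono) auto
          then show "\<bar>u x * (P j x * G j (g x - h t)) - u x * (P j x * ?T x)\<bar>
              \<le> PB j * (TB j * (L / real m) ^ N) * \<bar>u x\<bar>"
            by (simp add: mult.commute flip: abs_mult right_diff_distrib)
        qed (use int[OF u(1) \<F>(3)[OF j] j] T_int in auto)
        also have "\<dots> = PB j * TB j * L ^ N * (1 / real m) ^ N * (\<integral>x. \<bar>u x\<bar> \<partial>lebesgue_on \<Omega>)"
          by (simp add: power_divide)
        also have "\<dots> \<le> C1 * (1 / real m) ^ N * M"
          using C1[OF j] C_nonneg u_int[OF u] by (intro mult_mono) auto
        finally show "\<bar>\<Psi> j u (h t)\<bar> \<le> M * (C1 * (1 / real m) ^ N)"
          by (simp add: mult_ac)
      qed
    qed (use M C_nonneg W2 in auto)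
    also have "\<dots> = M * C1 * sqrt W2 * (1 / real m) ^ N"
      by simp
    also have "\<dots> \<le> C * (1 / real m) ^ N"
      unfolding C_def using M C_nonneg W2 by (intro mult_right_mono mult_left_mono) auto
    finally show ?thesis .
  qed
  have "\<exists>C'. \<forall>n\<ge>1. singular_value \<Omega> S' F n \<le> C' * real n powr (- e)"
    by (rule decay_from_power_count[of "DIM('c)" A0 C e N, OF _ _ _ _ N(2) small large])
       (use e M C_nonneg W2 in \<open>auto simp: A0_def C_def\<close>)
  with F_L2 show ?thesis
    by blast
qed

section \<open>The Langevin kernel\<close>

text \<open>By \<open>langevin_quotient_eq\<close> the field is y times a differentiable function of
  y, even at the origin, so the product rule applies; \<open>q 1\<close> comes from the derivative
  of \<open>q 0\<close>.\<close>

lemma langevin_field_has_derivative: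
  fixes y :: "'a::euclidean_space"
  assumes "\<beta> > 0"
  defines "q \<equiv> (\<lambda>m y :: 'a. inverse_power_sum (pi / \<beta>) m (y \<bullet> y))"
  shows "((\<lambda>y :: 'a. langevin_quotient \<beta> (norm y) *\<^sub>R y) has_derivative
    (\<lambda>v. (2 / \<beta>) *\<^sub>R (q 0 y *\<^sub>R v - (2 * (y \<bullet> v) * q 1 y) *\<^sub>R y))) (at y)"
proof -
  have a: "pi / \<beta> > 0"
    using assms by simp
  have "(q 0 has_derivative (\<lambda>v. - 2 * (y \<bullet> v) * q 1 y)) (at y)"
    using has_derivative_inverse_power_sum_inner[OF a, of 0 y] by (simp add: q_def)
  from has_derivative_scaleR_right[OF has_derivative_scaleR[OF this has_derivative_ident], of "2 / \<beta>"]
  have "((\<lambda>y. (2 / \<beta>) *\<^sub>R (q 0 y *\<^sub>R y)) has_derivative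
    (\<lambda>v. (2 / \<beta>) *\<^sub>R (q 0 y *\<^sub>R v - (2 * (y \<bullet> v) * q 1 y) *\<^sub>R y))) (at y)"
    by (rule has_derivative_eq_rhs) (simp add: fun_eq_iff)
  moreover have "(\<lambda>y :: 'a. langevin_quotient \<beta> (norm y) *\<^sub>R y) = (\<lambda>y. (2 / \<beta>) *\<^sub>R (q 0 y *\<^sub>R y))"
    using assms(1) by (simp add: fun_eq_iff langevin_quotient_eq power2_norm_eq_inner q_def)
  ultimately show ?thesis by simp
qed

text \<open>The empty list of directions gives a continuous extension of f itself to the compact
  closure.\<close>

lemma smooth_on_closure_measurable_bounded:
  assumes "smooth_on_closure S f" "S \<in> sets lebesgue" "bounded S"
  shows "f \<in> borel_measurable (lebesgue_on S)" "bounded (f ` S)"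
proof -
  obtain G where G: "continuous_on (closure S) G" "\<forall>x\<in>S. G x = f x"
    using assms(1) unfolding smooth_on_closure_def by (metis lists.Nil partials.simps(1))
  have "continuous_on S G"
    using G(1) closure_subset by (rule continuous_on_subset)
  then have "G \<in> borel_measurable (lebesgue_on S)"
    using assms(2) by (rule continuous_imp_measurable_on_sets_lebesgue)
  then show "f \<in> borel_measurable (lebesgue_on S)"
    by (rule measurable_lebesgue_cong[THEN iffD1, rotated]) (use G in simp)
  have "bounded (G ` closure S)"
    using assms(3) G(1) by (intro compact_imp_bounded compact_continuous_image) auto
  moreover have "f ` S \<subseteq> G ` closure S"
    using G(2) closure_subset by force
  ultimately show "bounded (f ` S)"
    by (rule bounded_subset)
qed

lemma inner_Basis_vec:
  fixes b :: "real ^ 'd"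
  assumes "b \<in> Basis"
  obtains i where "\<And>x :: real ^ 'd. x \<bullet> b = x $ i"
proof -
  obtain i where "b = axis i 1"
    using assms by (auto simp: Basis_vec_def)
  then show thesis
    using that[of i] by (simp add: inner_axis)
qed

text \<open>Sobolev functions are determined only up to null sets, while \<kappa> differentiates in
  t pointwise. Continuity of h selects the representative that is meant; it exists since s > 1/2.
  Where the derivative fails to exist, \<open>vector_derivative\<close> is an unspecified value, but
  this concerns a null set of times.\<close>

theorem theorem4p2:
  fixes \<Omega> :: "(real ^ 'd) set"
    and T \<mu>\<^sub>0 m\<^sub>0 \<beta> s r :: real
    and h :: "real \<Rightarrow> real ^ 'd"
    and g p :: "real ^ 'd \<Rightarrow> real ^ 'd"
    and H :: "real ^ 'd \<Rightarrow> real \<Rightarrow> real ^ 'd"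
    and \<kappa> :: "real ^ 'd \<Rightarrow> real \<Rightarrow> real"
    and F :: "(real ^ 'd \<Rightarrow> real) \<Rightarrow> real \<Rightarrow> real"
  assumes "CARD('d) \<in> {1, 2, 3}"
    and "bounded_lipschitz_domain \<Omega>"
    and "T > 0" and "\<mu>\<^sub>0 > 0" and "m\<^sub>0 > 0" and "\<beta> > 0"
    and "s > 3 / 2" and "\<And>i. (\<lambda>t. h t $ i) \<in> sobolev s {0<..<T}"
    and "continuous_on {0<..<T} h"
    and "r > real CARD('d) / 2" and "\<And>i. (\<lambda>x. g x $ i) \<in> sobolev r \<Omega>"
    and "\<And>i. smooth_on_closure \<Omega> (\<lambda>x. p x $ i)"
    and "\<And>x t. H x t = g x - h t"
    and "\<And>x t. \<kappa> x t = \<mu>\<^sub>0 * m\<^sub>0 *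
           (p x \<bullet> vector_derivative (\<lambda>\<tau>. langevin_quotient \<beta> (norm (H x \<tau>)) *\<^sub>R H x \<tau>) (at t))"
    and "\<And>c t. F c t = (\<integral>x. c x * \<kappa> x t \<partial>lebesgue_on \<Omega>)"
  shows "(\<forall>c\<in>L2 \<Omega>. F c \<in> L2 {0<..<T}) \<and>
    (\<exists>C. \<forall>n\<ge>1. singular_value \<Omega> {0<..<T} F n \<le> C * real n powr (- 1 / 2 - r / real CARD('d)))"
proof -
  let ?I = "{0<..<T}" and ?B = "Basis :: (real ^ 'd) set"
  have \<Omega>: "open \<Omega>" "bounded \<Omega>"
    using assms(2) by (auto simp: bounded_lipschitz_domain_def)
  then have \<Omega>_meas: "\<Omega> \<in> lmeasurable"
    by (rule lmeasurable_open[rotated])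
  then have \<Omega>_sets: "\<Omega> \<in> sets lebesgue"
    by blast
  have a: "pi / \<beta> > 0"
    using assms(6) by simp

  have "\<exists>v N. v \<in> L2 ?I \<and> negligible N \<and>
      (\<forall>t\<in>?I - N. ((\<lambda>t. h t \<bullet> b) has_real_derivative v t) (at t)) \<and> bounded ((\<lambda>t. h t \<bullet> b) ` ?I)"
    if b: "b \<in> ?B" for b
  proof -
    obtain i where i: "\<And>x :: real ^ 'd. x \<bullet> b = x $ i"
      using inner_Basis_vec[OF b] by metis
    have "continuous_on ?I (\<lambda>t. h t $ i)"
      using assms(9) by (intro continuous_on_component)
    then obtain v N where "v \<in> L2 ?I" "negligible N"
      "\<And>t. t \<in> ?I - N \<Longrightarrow> ((\<lambda>t. h t $ i) has_real_derivative v t) (at t)" "bounded ((\<lambda>t. h t $ i) ` ?I)"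
      using sobolev_real_AE_derivative[OF assms(8)[of i]] assms(3,7) by auto
    then show ?thesis
      unfolding i by blast
  qed
  then obtain V N where V: "\<And>b. b \<in> ?B \<Longrightarrow> V b \<in> L2 ?I" and N: "\<And>b. b \<in> ?B \<Longrightarrow> negligible (N b)"
    and D: "\<And>b t. b \<in> ?B \<Longrightarrow> t \<in> ?I - N b \<Longrightarrow> ((\<lambda>t. h t \<bullet> b) has_real_derivative V b t) (at t)"
    and h_bounded: "\<And>b. b \<in> ?B \<Longrightarrow> bounded ((\<lambda>t. h t \<bullet> b) ` ?I)"
    by metis
  define N0 where "N0 = (\<Union>b\<in>?B. N b)"
  define h' where "h' t = (\<Sum>b\<in>?B. V b t *\<^sub>R b)" for t
  have h': "(h has_vector_derivative h' t) (at t)" if t: "t \<in> ?I - N0" for t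
  proof -
    have "((\<lambda>t. \<Sum>b\<in>?B. (h t \<bullet> b) *\<^sub>R b) has_vector_derivative h' t) (at t)"
      unfolding h'_def
    proof (rule has_vector_derivative_sum)
      fix b :: "real ^ 'd" assume b: "b \<in> ?B"
      then have "((\<lambda>t. h t \<bullet> b) has_real_derivative V b t) (at t)"
        using t by (intro D) (auto simp: N0_def)
      from has_vector_derivative_scaleR[OF this has_vector_derivative_const[of b]]
      show "((\<lambda>t. (h t \<bullet> b) *\<^sub>R b) has_vector_derivative V b t *\<^sub>R b) (at t)"
        by simp
    qed
    then show ?thesis
      by (simp add: euclidean_representation)
  qed

  define q where "q m y = inverse_power_sum (pi / \<beta>) m (y \<bullet> y)" for m and y :: "real ^ 'd"
  \<comment> \<open>\<open>G (b, b')\<close> is the component along b of the Jacobian of the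
    Langevin field applied to b', read off from
    \<open>langevin_field_has_derivative\<close>.\<close>
  define G where "G = (\<lambda>(b, b') y. (2 / \<beta>) * (b \<bullet> b') * q 0 y - (4 / \<beta>) * (y \<bullet> b) * (y \<bullet> b') * q 1 y)"
  \<comment> \<open>The minus sign comes from differentiating \<open>g x - h t\<close> in t.\<close>
  define P where "P = (\<lambda>(b :: real ^ 'd, b' :: real ^ 'd) x. - (\<mu>\<^sub>0 * m\<^sub>0) * (p x \<bullet> b))"
  define W where "W = (\<lambda>(b :: real ^ 'd, b'). V b')"
  have G_symbol: "G j \<in> radial_symbols (pi / \<beta>)" for j
  proof -
    obtain b b' where j: "j = (b, b')" by (cases j)
    \<comment> \<open>Degree 2 is the bound 2 m for m = 1, so the quadratic factor in front of
      \<open>q 1\<close> is admissible.\<close>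
    have "polynomial_of_degree (Suc (Suc 0)) (\<lambda>y. (y \<bullet> b) * ((y \<bullet> b') * (- (4 / \<beta>))))"
      by (rule polynomial_of_degree.inner)+ (rule polynomial_of_degree.const)
    moreover have "Suc (Suc 0) = 2 * 1"
      by simp
    ultimately have "polynomial_of_degree (2 * 1) (\<lambda>y. (y \<bullet> b) * ((y \<bullet> b') * (- (4 / \<beta>))))"
      by metis
    then have "(\<lambda>y. (2 / \<beta> * (b \<bullet> b')) * inverse_power_sum (pi / \<beta>) 0 (y \<bullet> y)
        + ((y \<bullet> b) * ((y \<bullet> b') * (- (4 / \<beta>)))) * inverse_power_sum (pi / \<beta>) 1 (y \<bullet> y)) \<in> radial_symbols (pi / \<beta>)"
      by (intro radial_symbols.add radial_symbols.base polynomial_of_degree.const)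
    then show ?thesis
      by (simp add: G_def j q_def algebra_simps)
  qed
  have \<kappa>_eq: "\<kappa> x t = (\<Sum>j\<in>?B \<times> ?B. P j x * G j (g x - h t) * W j t)" if t: "t \<in> ?I - N0" for x t
  proof -
    define y where "y = g x - h t"
    let ?D = "\<lambda>v. (2 / \<beta>) *\<^sub>R (q 0 y *\<^sub>R v - (2 * (y \<bullet> v) * q 1 y) *\<^sub>R y)"
    have "((\<lambda>\<tau>. g x - h \<tau>) has_vector_derivative - h' t) (at t)"
      using has_vector_derivative_diff[OF has_vector_derivative_const h'[OF t]] by simp
    from vector_derivative_diff_chain_within[OF this has_derivative_at_withinI[OF
      langevin_field_has_derivative[OF assms(6), of "g x - h t"]]]
    have "((\<lambda>\<tau>. langevin_quotient \<beta> (norm (H x \<tau>)) *\<^sub>R H x \<tau>) has_vector_derivative ?D (- h' t)) (at t)"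
      by (simp add: o_def assms(13) q_def y_def)
    then have "\<kappa> x t = \<mu>\<^sub>0 * m\<^sub>0 * (p x \<bullet> ?D (- h' t))"
      unfolding assms(14) by (simp only: vector_derivative_at)
    also have "\<dots> = - (\<mu>\<^sub>0 * m\<^sub>0) * ((2 / \<beta>) * q 0 y * (p x \<bullet> h' t) - (4 / \<beta>) * q 1 y * (p x \<bullet> y) * (y \<bullet> h' t))"
    proof -
      have "p' \<bullet> ((2 / \<beta>) *\<^sub>R (q0 *\<^sub>R (- v) - (2 * (y \<bullet> (- v)) * q1) *\<^sub>R y))
          = - ((2 / \<beta>) * q0 * (p' \<bullet> v) - (4 / \<beta>) * q1 * (p' \<bullet> y) * (y \<bullet> v))"
        for p' v y :: "real ^ 'd" and q0 q1 :: real
        by (simp add: inner_diff_right algebra_simps)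
      then show ?thesis
        by (simp only: mult_minus_left mult_minus_right)
    qed
    \<comment> \<open>Inserting \<open>b \<bullet> b'\<close>, which is 1 on the diagonal and 0 off
      it, makes both terms of the Jacobian sums over the same pairs (b, b').\<close>
    also have "p x \<bullet> h' t = (\<Sum>b\<in>?B. \<Sum>b'\<in>?B. (p x \<bullet> b) * (b \<bullet> b') * V b' t)"
    proof -
      have "p x \<bullet> h' t = (\<Sum>b'\<in>?B. V b' t * (p x \<bullet> b'))"
        by (simp add: h'_def inner_sum_right)
      also have "\<dots> = (\<Sum>b'\<in>?B. V b' t * (\<Sum>b\<in>?B. (p x \<bullet> b) * (b' \<bullet> b)))"
        by (subst euclidean_inner[of "p x"]) simp
      also have "\<dots> = (\<Sum>b'\<in>?B. \<Sum>b\<in>?B. (p x \<bullet> b) * (b \<bullet> b') * V b' t)"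
        by (simp add: sum_distrib_left mult_ac inner_commute)
      finally show ?thesis
        by (subst sum.swap)
    qed
    also have "(4 / \<beta>) * q 1 y * (p x \<bullet> y) * (y \<bullet> h' t)
        = (4 / \<beta>) * q 1 y * (\<Sum>b\<in>?B. \<Sum>b'\<in>?B. (p x \<bullet> b) * (y \<bullet> b) * ((y \<bullet> b') * V b' t))"
    proof -
      have "y \<bullet> h' t = (\<Sum>b'\<in>?B. (y \<bullet> b') * V b' t)"
        by (simp only: h'_def inner_sum_right inner_scaleR_right mult.commute)
      moreover have "p x \<bullet> y = (\<Sum>b\<in>?B. (p x \<bullet> b) * (y \<bullet> b))"
        by (rule euclidean_inner)
      ultimately show ?thesis
        by (simp only: sum_product mult.assoc)
    qed
    also have "- (\<mu>\<^sub>0 * m\<^sub>0) * ((2 / \<beta>) * q 0 y * (\<Sum>b\<in>?B. \<Sum>b'\<in>?B. (p x \<bullet> b) * (b \<bullet> b') * V b' t)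
        - (4 / \<beta>) * q 1 y * (\<Sum>b\<in>?B. \<Sum>b'\<in>?B. (p x \<bullet> b) * (y \<bullet> b) * ((y \<bullet> b') * V b' t)))
      = (\<Sum>b\<in>?B. \<Sum>b'\<in>?B. P (b, b') x * G (b, b') y * W (b, b') t)"
      unfolding sum_distrib_left sum_subtractf[symmetric]
      by (intro sum.cong refl) (simp add: P_def G_def W_def algebra_simps)
    finally show ?thesis
      by (simp add: sum.cartesian_product y_def)
  qed
  have p_props: "(\<lambda>x. p x \<bullet> b) \<in> borel_measurable (lebesgue_on \<Omega>)" "bounded ((\<lambda>x. p x \<bullet> b) ` \<Omega>)"
    if b: "b \<in> ?B" for b
  proof -
    obtain i where i: "\<And>x :: real ^ 'd. x \<bullet> b = x $ i"
      using inner_Basis_vec[OF b] by metis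
    show "(\<lambda>x. p x \<bullet> b) \<in> borel_measurable (lebesgue_on \<Omega>)" "bounded ((\<lambda>x. p x \<bullet> b) ` \<Omega>)"
      unfolding i using smooth_on_closure_measurable_bounded[OF assms(12) \<Omega>_sets \<Omega>(2)] by auto
  qed
  \<comment> \<open>The choice e = 1/2 + r/d turns the condition on the Taylor order into N \<ge>
    d/2 + r.\<close>
  have "(\<forall>c\<in>L2 \<Omega>. F c \<in> L2 ?I) \<and>
    (\<exists>C. \<forall>n\<ge>1. singular_value \<Omega> ?I F n \<le> C * real n powr - (1 / 2 + r / real CARD('d)))"
  proof (rule difference_kernel_singular_values[where J = "?B \<times> ?B" and P = P and G = G and V = W
        and g = g and h = h and \<F> = "radial_symbols (pi / \<beta>)" and ?N0.0 = N0])
    show "P j \<in> borel_measurable (lebesgue_on \<Omega>)" if "j \<in> ?B \<times> ?B" for j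
      using p_props(1) that by (auto simp: P_def)
    show "bounded (P j ` \<Omega>)" if "j \<in> ?B \<times> ?B" for j
    proof -
      have "bounded ((\<lambda>x. - (\<mu>\<^sub>0 * m\<^sub>0) * x) ` (\<lambda>x. p x \<bullet> fst j) ` \<Omega>)"
        using that by (intro bounded_linear_image[OF p_props(2) bounded_linear_mult_right]) auto
      then show ?thesis
        by (simp add: P_def image_image case_prod_unfold)
    qed
    show "differentiation_closed (radial_symbols (pi / \<beta>))"
      by (rule differentiation_closed_radial_symbols[OF a])
    show "bounded (range f)" if "f \<in> radial_symbols (pi / \<beta>)" for f
      by (rule bounded_radial_symbols[OF a that])
    show "W j \<in> L2 ?I" if "j \<in> ?B \<times> ?B" for j
      using V that by (auto simp: W_def)
    show "g \<in> borel_measurable (lebesgue_on \<Omega>)"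
    proof (subst borel_measurable_euclidean_space, rule ballI)
      fix b assume "b \<in> ?B"
      then obtain i where i: "\<And>x :: real ^ 'd. x \<bullet> b = x $ i"
        using inner_Basis_vec by metis
      show "(\<lambda>x. g x \<bullet> b) \<in> borel_measurable (lebesgue_on \<Omega>)"
        using assms(11)[of i] unfolding i by (simp add: sobolev_def L2_def)
    qed
    show "h \<in> borel_measurable (lebesgue_on ?I)"
      using assms(9) by (intro continuous_imp_measurable_on_sets_lebesgue) auto
    show "bounded (h ` ?I)"
    proof -
      have "\<exists>M. \<forall>t\<in>?I. \<bar>h t \<bullet> b\<bar> \<le> M" if "b \<in> ?B" for b
        using h_bounded[OF that] by (auto simp: bounded_iff)
      then obtain M where M: "\<And>b t. b \<in> ?B \<Longrightarrow> t \<in> ?I \<Longrightarrow> \<bar>h t \<bullet> b\<bar> \<le> M b"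
        by metis
      have "norm (h t) \<le> (\<Sum>b\<in>?B. M b)" if "t \<in> ?I" for t
        using norm_le_l1[of "h t"] sum_mono[of ?B "\<lambda>b. \<bar>h t \<bullet> b\<bar>" M] M that by fastforce
      then show ?thesis
        by (intro boundedI[of _ "\<Sum>b\<in>?B. M b"]) auto
    qed
    show "negligible N0"
      unfolding N0_def using N by (intro negligible_Union) auto
    show "F c t = (\<integral>x. c x * (\<Sum>j\<in>?B \<times> ?B. P j x * G j (g x - h t) * W j t) \<partial>lebesgue_on \<Omega>)"
      if "t \<in> ?I - N0" for c t
      unfolding assms(15) \<kappa>_eq[OF that] ..
    show "0 < 1 / 2 + r / real CARD('d)"
      using assms(10) by (intro add_pos_nonneg divide_nonneg_nonneg) auto
  qed (use \<Omega>_meas G_symbol in auto)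
  then show ?thesis
    by (simp add: minus_add_distrib)
qed

end
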